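(* Let $F_2$ be the free group of rank two, let $F_2'$ be an isomorphic copy of $F_2$, and let $G=F_2\times F_2'$. If $H$ is a finitely presented subgroup of $G$, then $H$ is closed in the profinite topology of $G$.
   Context: The profinite topology on a group $G$ is the topology with the cosets of finite index normal subgroups as a base of open sets; a subgroup $H$ is closed if and only if $H=\bigcap_N HN$, where $N$ ranges over all finite index normal subgroups of $G$. *)

theory Defs
  imports "HOL-Algebra.Generated_Groups" "HOL-Analysis.Abstract_Topology"
begin

section \<open>Free groups\<close>

text \<open>A letter \<open>(x, True)\<close> stands for the generator \<open>x\<close>, and \<open>(x, False)\<close> for its inverse.
  The free group on \<open>X\<close> consists of the reduced words over \<open>X\<close>, with concatenation followed
  by free reduction as multiplication.\<close>

fun flip_letter :: "'a \<times> bool \<Rightarrow> 'a \<times> bool" where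
  "flip_letter (x, b) = (x, \<not> b)"

fun reduced :: "('a \<times> bool) list \<Rightarrow> bool" where
  "reduced [] \<longleftrightarrow> True"
| "reduced [a] \<longleftrightarrow> True"
| "reduced (a # b # w) \<longleftrightarrow> b \<noteq> flip_letter a \<and> reduced (b # w)"

fun push_letter :: "'a \<times> bool \<Rightarrow> ('a \<times> bool) list \<Rightarrow> ('a \<times> bool) list" where
  "push_letter a [] = [a]"
| "push_letter a (b # w) = (if b = flip_letter a then w else a # b # w)"

definition free_group :: "'a set \<Rightarrow> ('a \<times> bool) list monoid" where
  "free_group X =
     \<lparr>carrier = {w. reduced w \<and> fst ` set w \<subseteq> X}, monoid.mult = foldr push_letter, one = []\<rparr>"

lemma flip_letter_flip [simp]: "flip_letter (flip_letter a) = a"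
  by (cases a) auto

lemma fst_flip_letter [simp]: "fst (flip_letter a) = fst a"
  by (cases a) auto

lemma flip_letter_eq_iff: "flip_letter a = b \<longleftrightarrow> a = flip_letter b"
  by auto

lemma reduced_ConsD: "reduced (a # w) \<Longrightarrow> reduced w"
  by (cases w) auto

lemma reduced_push: "reduced w \<Longrightarrow> reduced (push_letter a w)"
  by (cases w) (auto dest: reduced_ConsD)

lemma reduced_mult: "reduced v \<Longrightarrow> reduced (foldr push_letter u v)"
  by (induction u) (auto intro: reduced_push)

lemma push_flip_push: "reduced w \<Longrightarrow> push_letter (flip_letter a) (push_letter a w) = w"
  by (induction w rule: reduced.induct) auto

lemma push_push_flip: "reduced w \<Longrightarrow> push_letter a (push_letter (flip_letter a) w) = w"
  using push_flip_push[of w "flip_letter a"] by simp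

lemma push_eq_Cons: "reduced (a # w) \<Longrightarrow> push_letter a w = a # w"
  by (cases w) auto

lemma mult_push:
  assumes "reduced w"
  shows "foldr push_letter (push_letter a u) w = push_letter a (foldr push_letter u w)"
  by (cases u) (auto simp: push_push_flip reduced_mult assms)

lemma mult_assoc_word:
  assumes "reduced w"
  shows "foldr push_letter (foldr push_letter u v) w
    = foldr push_letter u (foldr push_letter v w)"
  by (induction u) (auto simp: mult_push assms)

lemma letters_push: "fst ` set (push_letter a w) \<subseteq> insert (fst a) (fst ` set w)"
  by (cases w) auto

lemma letters_mult: "fst ` set (foldr push_letter u v) \<subseteq> fst ` set u \<union> fst ` set v"
proof (induction u)
  case (Cons a u)
  then show ?case using letters_push[of a "foldr push_letter u v"]
    unfolding foldr.simps comp_apply list.set image_insert by blast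
qed simp

lemma mult_Nil: "reduced u \<Longrightarrow> foldr push_letter u [] = u"
proof (induction u)
  case (Cons a u)
  then show ?case using reduced_ConsD[OF Cons.prems] push_eq_Cons[OF Cons.prems] by simp
qed simp

lemma reduced_snoc: "reduced (w @ [b, a]) \<longleftrightarrow> a \<noteq> flip_letter b \<and> reduced (w @ [b])"
  by (induction w rule: reduced.induct) auto

lemma reduced_inverse: "reduced w \<Longrightarrow> reduced (rev (map flip_letter w))"
  by (induction w rule: reduced.induct) (auto simp: reduced_snoc flip_letter_eq_iff)

lemma inverse_mult: "reduced w \<Longrightarrow> foldr push_letter (rev (map flip_letter w)) w = []"
  by (induction w) (auto dest: reduced_ConsD)

lemma carrier_free_group:
  "w \<in> carrier (free_group X) \<longleftrightarrow> reduced w \<and> fst ` set w \<subseteq> X"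
  by (simp add: free_group_def)

lemma mult_free_group: "u \<otimes>\<^bsub>free_group X\<^esub> v = foldr push_letter u v"
  by (simp add: free_group_def)

lemma one_free_group: "\<one>\<^bsub>free_group X\<^esub> = []"
  by (simp add: free_group_def)

lemma group_free_group: "group (free_group X)"
proof (rule groupI)
  fix u v assume "u \<in> carrier (free_group X)" "v \<in> carrier (free_group X)"
  then show "u \<otimes>\<^bsub>free_group X\<^esub> v \<in> carrier (free_group X)"
    using subset_trans[OF letters_mult[of u v] Un_least[of _ X]]
    by (simp add: carrier_free_group mult_free_group reduced_mult)
next
  fix u assume u: "u \<in> carrier (free_group X)"
  show "\<exists>v\<in>carrier (free_group X). v \<otimes>\<^bsub>free_group X\<^esub> u = \<one>\<^bsub>free_group X\<^esub>"
    using u by (intro bexI[of _ "rev (map flip_letter u)"])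
      (auto simp: carrier_free_group mult_free_group one_free_group inverse_mult reduced_inverse)
qed (auto simp: carrier_free_group mult_free_group one_free_group mult_assoc_word)

text \<open>Sanity check, the universal property: every map from \<open>X\<close> to a group extends uniquely
  to a homomorphism.\<close>

lemma free_group_extend:
  assumes "group G" and f: "f \<in> X \<rightarrow> carrier G"
  shows "\<exists>h \<in> hom (free_group X) G. \<forall>x\<in>X. h [(x, True)] = f x"
proof -
  interpret group G by fact
  define l where "l = (\<lambda>a. if snd a then f (fst a) else inv\<^bsub>G\<^esub> f (fst a))"
  define h where "h = (\<lambda>w. foldr (\<lambda>a g. l a \<otimes>\<^bsub>G\<^esub> g) w \<one>\<^bsub>G\<^esub>)"
  have l: "l a \<in> carrier G" if "fst a \<in> X" for a
    using f that by (auto simp: l_def)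
  have l_flip: "l a \<otimes>\<^bsub>G\<^esub> l (flip_letter a) = \<one>\<^bsub>G\<^esub>" if "fst a \<in> X" for a
    using f that by (cases a) (auto simp: l_def Pi_iff)
  have h_closed: "h w \<in> carrier G" if "fst ` set w \<subseteq> X" for w
    using that by (induction w) (auto simp: h_def l)
  have h_push: "h (push_letter a w) = l a \<otimes>\<^bsub>G\<^esub> h w"
    if "fst a \<in> X" "fst ` set w \<subseteq> X" for a w
  proof (cases w)
    case (Cons b v)
    have v: "h v \<in> carrier G" using that Cons h_closed by auto
    show ?thesis
    proof (cases "b = flip_letter a")
      case True
      have "l a \<otimes>\<^bsub>G\<^esub> (l b \<otimes>\<^bsub>G\<^esub> h v) = (l a \<otimes>\<^bsub>G\<^esub> l b) \<otimes>\<^bsub>G\<^esub> h v"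
        using that v True l[of a] l[of b] by (simp add: m_assoc)
      also have "\<dots> = h v" using True that v l_flip by simp
      finally show ?thesis using Cons True by (simp add: h_def)
    qed (simp add: Cons h_def)
  qed (simp add: h_def)
  have h_mult: "h (foldr push_letter u v) = h u \<otimes>\<^bsub>G\<^esub> h v"
    if "fst ` set u \<subseteq> X" "fst ` set v \<subseteq> X" for u v
    using that(1)
  proof (induction u)
    case Nil
    then show ?case using h_closed[OF that(2)] by (simp add: h_def)
  next
    case (Cons a u)
    have "fst ` set (foldr push_letter u v) \<subseteq> X"
      using letters_mult[of u v] Cons.prems that(2)
      unfolding list.set image_insert by blast
    then have "h (foldr push_letter (a # u) v) = l a \<otimes>\<^bsub>G\<^esub> (h u \<otimes>\<^bsub>G\<^esub> h v)"
      using Cons h_push by simp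
    also have "\<dots> = h (a # u) \<otimes>\<^bsub>G\<^esub> h v"
      using Cons.prems l[of a] h_closed[of u] h_closed[OF that(2)]
      by (simp add: h_def m_assoc)
    finally show ?case .
  qed
  have "h \<in> hom (free_group X) G"
    by (rule homI) (auto simp: carrier_free_group mult_free_group h_closed h_mult)
  moreover have "h [(x, True)] = f x" if "x \<in> X" for x
    using funcset_mem[OF f that] by (simp add: h_def l_def)
  ultimately show ?thesis by blast
qed

lemma free_group_extend_unique:
  assumes "group G" and h: "h \<in> hom (free_group X) G" and k: "k \<in> hom (free_group X) G"
    and eq: "\<And>x. x \<in> X \<Longrightarrow> h [(x, True)] = k [(x, True)]"
    and w: "w \<in> carrier (free_group X)"
  shows "h w = k w"
proof -
  interpret F: group "free_group X" by (rule group_free_group)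
  interpret h: group_hom "free_group X" G h
    using assms by (simp add: group_hom_def group_hom_axioms_def group_free_group)
  interpret k: group_hom "free_group X" G k
    using assms by (simp add: group_hom_def group_hom_axioms_def group_free_group)
  have letter: "h [a] = k [a]" if "fst a \<in> X" for a
  proof -
    obtain x b where a: "a = (x, b)" by (cases a)
    have x: "x \<in> X" using that a by simp
    have gen: "[(x, True)] \<in> carrier (free_group X)" using x by (simp add: carrier_free_group)
    have "inv\<^bsub>free_group X\<^esub> [(x, True)] = [(x, False)]"
      by (rule F.inv_equality) (use x in \<open>auto simp: carrier_free_group mult_free_group one_free_group\<close>)
    then have "h [(x, False)] = k [(x, False)]"
      using h.hom_inv[OF gen] k.hom_inv[OF gen] eq[OF x] by simp
    then show ?thesis using a eq[OF x] by (cases b) auto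
  qed
  show ?thesis using w
  proof (induction w)
    case Nil
    show ?case using h.hom_one k.hom_one by (simp add: one_free_group)
  next
    case (Cons a w)
    have a: "[a] \<in> carrier (free_group X)" "fst a \<in> X" and w: "w \<in> carrier (free_group X)"
      using Cons.prems by (auto simp: carrier_free_group dest: reduced_ConsD)
    have "a # w = [a] \<otimes>\<^bsub>free_group X\<^esub> w"
      using Cons.prems by (simp add: mult_free_group carrier_free_group push_eq_Cons)
    then show ?case using h.hom_mult[OF a(1) w] k.hom_mult[OF a(1) w] letter[OF a(2)] Cons.IH[OF w]
      by simp
  qed
qed

definition free_group_of_rank :: "nat \<Rightarrow> ('a, 'm) monoid_scheme \<Rightarrow> bool" where
  "free_group_of_rank n F \<longleftrightarrow> group F \<and> F \<cong> free_group {..<n}"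

section \<open>Finite presentations\<close>

definition normal_closure :: "('a, 'm) monoid_scheme \<Rightarrow> 'a set \<Rightarrow> 'a set" where
  "normal_closure G R = \<Inter> {N. N \<lhd> G \<and> R \<subseteq> N}"

definition finitely_presented :: "('a, 'm) monoid_scheme \<Rightarrow> bool" where
  "finitely_presented G \<longleftrightarrow> group G \<and>
     (\<exists>(n::nat) R. finite R \<and> R \<subseteq> carrier (free_group {..<n}) \<and>
        G \<cong> free_group {..<n} Mod normal_closure (free_group {..<n}) R)"

lemma (in group) normal_closure_normal:
  assumes "R \<subseteq> carrier G"
  shows "normal_closure G R \<lhd> G"
proof -
  have "subgroup (\<Inter> {N. N \<lhd> G \<and> R \<subseteq> N}) G"
  proof (rule subgroups_Inter)
    show "{N. N \<lhd> G \<and> R \<subseteq> N} \<noteq> {}"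
      using assms normal_self by blast
  qed (blast intro: normal_imp_subgroup)
  then show ?thesis
    unfolding normal_closure_def
  proof (rule normal_invI)
    fix x h assume x: "x \<in> carrier G" and h: "h \<in> \<Inter> {N. N \<lhd> G \<and> R \<subseteq> N}"
    show "x \<otimes> h \<otimes> inv x \<in> \<Inter> {N. N \<lhd> G \<and> R \<subseteq> N}"
    proof (rule InterI)
      fix N assume N: "N \<in> {N. N \<lhd> G \<and> R \<subseteq> N}"
      then have "N \<lhd> G" "h \<in> N" using h by auto
      then show "x \<otimes> h \<otimes> inv x \<in> N" by (rule normal.inv_op_closed2[OF _ x])
    qed
  qed
qed

section \<open>The profinite topology\<close>

definition finite_index_normal :: "('a, 'm) monoid_scheme \<Rightarrow> 'a set \<Rightarrow> bool" where
  "finite_index_normal G N \<longleftrightarrow> N \<lhd> G \<and> finite (rcosets\<^bsub>G\<^esub> N)"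

definition profinite_topology :: "('a, 'm) monoid_scheme \<Rightarrow> 'a topology" where
  "profinite_topology G = topology (arbitrary union_of
     (\<lambda>U. \<exists>N. finite_index_normal G N \<and> U \<in> rcosets\<^bsub>G\<^esub> N))"

lemma (in group) finite_index_normal_Int:
  assumes N: "finite_index_normal G N" and M: "finite_index_normal G M"
  shows "finite_index_normal G (N \<inter> M)"
proof -
  have sub: "subgroup N G" "subgroup M G" "subgroup (N \<inter> M) G"
    using assms by (auto simp: finite_index_normal_def normal_imp_subgroup intro!: subgroups_Inter_pair)
  have "N \<inter> M \<lhd> G"
    using assms sub(3) by (auto simp: finite_index_normal_def normal_inv_iff)
  moreover have "finite (rcosets (N \<inter> M))"
  proof (rule finite_subset)
    show "rcosets (N \<inter> M) \<subseteq> (\<lambda>(A, B). A \<inter> B) ` ((rcosets N) \<times> (rcosets M))"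
    proof
      fix C assume "C \<in> rcosets (N \<inter> M)"
      then obtain g where g: "g \<in> carrier G" "C = (N \<inter> M) #> g" by (auto simp: RCOSETS_def)
      have "(N \<inter> M) #> g = (N #> g) \<inter> (M #> g)"
      proof
        show "(N #> g) \<inter> (M #> g) \<subseteq> (N \<inter> M) #> g"
        proof
          fix x assume "x \<in> (N #> g) \<inter> (M #> g)"
          then obtain n m where nm: "n \<in> N" "m \<in> M" "x = n \<otimes> g" "x = m \<otimes> g"
            by (auto simp: r_coset_def)
          then have "n = m"
            using g(1) subgroup.mem_carrier[OF sub(1)] subgroup.mem_carrier[OF sub(2)] by auto
          then show "x \<in> (N \<inter> M) #> g" using nm by (auto simp: r_coset_def)
        qed
      qed (auto simp: r_coset_def)
      then show "C \<in> (\<lambda>(A, B). A \<inter> B) ` ((rcosets N) \<times> (rcosets M))"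
        using g by (auto simp: RCOSETS_def intro!: image_eqI[of _ _ "(N #> g, M #> g)"])
    qed
    show "finite ((\<lambda>(A, B). A \<inter> B) ` ((rcosets N) \<times> (rcosets M)))"
      using assms by (auto simp: finite_index_normal_def)
  qed
  ultimately show ?thesis by (simp add: finite_index_normal_def)
qed

lemma (in group) openin_profinite_topology:
  "openin (profinite_topology G) = arbitrary union_of
     (\<lambda>U. \<exists>N. finite_index_normal G N \<and> U \<in> rcosets N)" (is "_ = arbitrary union_of ?B")
proof -
  have "(arbitrary union_of ?B) (S \<inter> T)" if "?B S" "?B T" for S T
  proof -
    from that obtain N M where N: "finite_index_normal G N" "S \<in> rcosets N"
      and M: "finite_index_normal G M" "T \<in> rcosets M" by blast
    have sub: "subgroup N G" "subgroup M G" "subgroup (N \<inter> M) G"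
      using N(1) M(1) finite_index_normal_Int[OF N(1) M(1)]
      by (auto simp: finite_index_normal_def normal_imp_subgroup)
    have "\<exists>U. ?B U \<and> x \<in> U \<and> U \<subseteq> S \<inter> T" if x: "x \<in> S \<inter> T" for x
    proof -
      have xG: "x \<in> carrier G"
        using x N(2) rcosets_part_G[OF sub(1)] by auto
      have "S = N #> x" "T = M #> x"
        using x N(2) M(2) sub repr_independence by (auto simp: RCOSETS_def)
      then have "(N \<inter> M) #> x \<subseteq> S \<inter> T" by (auto simp: r_coset_def)
      moreover have "x \<in> (N \<inter> M) #> x" using rcos_self[OF xG sub(3)] .
      moreover have "?B ((N \<inter> M) #> x)"
        using finite_index_normal_Int[OF N(1) M(1)] xG by (auto simp: RCOSETS_def)
      ultimately show ?thesis by blast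
    qed
    then show ?thesis
      unfolding arbitrary_union_of_alt by blast
  qed
  then have "istopology (arbitrary union_of ?B)"
    by (auto simp: istopology_base_eq)
  then show ?thesis
    by (simp add: profinite_topology_def topology_inverse')
qed

lemma (in group) topspace_profinite_topology: "topspace (profinite_topology G) = carrier G"
proof
  show "topspace (profinite_topology G) \<subseteq> carrier G"
  proof
    fix x assume "x \<in> topspace (profinite_topology G)"
    then have "(arbitrary union_of (\<lambda>U. \<exists>N. finite_index_normal G N \<and> U \<in> rcosets N))
        (topspace (profinite_topology G))"
      using openin_topspace[of "profinite_topology G"] by (simp add: openin_profinite_topology)
    then obtain U N where U: "finite_index_normal G N" "U \<in> rcosets N" "x \<in> U"
      unfolding arbitrary_union_of_alt
      using \<open>x \<in> topspace (profinite_topology G)\<close> by blast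
    then show "x \<in> carrier G"
      using rcosets_part_G[of N] by (auto simp: finite_index_normal_def normal_imp_subgroup)
  qed
  have "rcosets (carrier G) = {carrier G}"
    using coset_join2[OF _ subgroup_self] one_closed by (auto simp: RCOSETS_def)
  then have "finite_index_normal G (carrier G)" "carrier G \<in> rcosets (carrier G)"
    by (auto simp: finite_index_normal_def normal_self)
  then have "openin (profinite_topology G) (carrier G)"
    unfolding openin_profinite_topology by (intro arbitrary_union_of_inc) auto
  then show "carrier G \<subseteq> topspace (profinite_topology G)"
    by (rule openin_subset)
qed

lemma (in group) closedin_profinite_topology_iff:
  assumes H: "subgroup H G"
  shows "closedin (profinite_topology G) H \<longleftrightarrow>
    H = \<Inter> {H <#> N |N. finite_index_normal G N}"
proof -
  have HG: "H \<subseteq> carrier G" using H by (rule subgroup.subset)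
  have mem: "x \<in> H <#> N \<longleftrightarrow> (N #> x) \<inter> H \<noteq> {}"
    if "finite_index_normal G N" "x \<in> carrier G" for N x
  proof -
    have N: "N \<lhd> G" and sN: "subgroup N G"
      using that by (auto simp: finite_index_normal_def normal_imp_subgroup)
    have "H <#> N = N <#> H"
      using commut_normal[OF H N] .
    moreover have "x \<in> N <#> H \<longleftrightarrow> (N #> x) \<inter> H \<noteq> {}"
    proof
      assume "x \<in> N <#> H"
      then obtain n k where nk: "n \<in> N" "k \<in> H" "x = n \<otimes> k" by (auto simp: set_mult_def)
      have c: "n \<in> carrier G" "k \<in> carrier G" using nk(1,2) HG subgroup.subset[OF sN] by auto
      have "k = inv n \<otimes> x" using nk(3) c by (simp add: m_assoc[symmetric])
      moreover have "inv n \<in> N" using subgroup.m_inv_closed[OF sN nk(1)] .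
      ultimately show "(N #> x) \<inter> H \<noteq> {}" using nk by (auto simp: r_coset_def)
    next
      assume "(N #> x) \<inter> H \<noteq> {}"
      then obtain n where n: "n \<in> N" "n \<otimes> x \<in> H" by (auto simp: r_coset_def)
      have c: "n \<in> carrier G" using n(1) subgroup.subset[OF sN] by auto
      have "x = inv n \<otimes> (n \<otimes> x)" using c that(2) by (simp add: m_assoc[symmetric])
      moreover have "inv n \<in> N" using subgroup.m_inv_closed[OF sN n(1)] .
      ultimately show "x \<in> N <#> H" using n by (auto simp: set_mult_def)
    qed
    ultimately show ?thesis by simp
  qed
  have cos: "U = N #> x" if "finite_index_normal G N" "U \<in> rcosets N" "x \<in> U" for U N x
    using that repr_independence normal_imp_subgroup
    unfolding RCOSETS_def finite_index_normal_def by blast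
  have self: "x \<in> N #> x" "N #> x \<in> rcosets N" if "finite_index_normal G N" "x \<in> carrier G" for N x
    using that rcos_self normal_imp_subgroup
    unfolding RCOSETS_def finite_index_normal_def by blast+
  have "closedin (profinite_topology G) H \<longleftrightarrow>
      (\<forall>x\<in>carrier G - H. \<exists>N. finite_index_normal G N \<and> N #> x \<subseteq> carrier G - H)"
    unfolding closedin_def topspace_profinite_topology openin_profinite_topology arbitrary_union_of_alt
    using HG cos self by (smt (verit, ccfv_SIG) DiffD1)
  also have "\<dots> \<longleftrightarrow> (\<forall>x\<in>carrier G - H. \<exists>N. finite_index_normal G N \<and> x \<notin> H <#> N)"
  proof -
    have "N #> x \<subseteq> carrier G - H \<longleftrightarrow> x \<notin> H <#> N"
      if "finite_index_normal G N" "x \<in> carrier G" for N x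
      using mem[OF that] rcosets_part_G[of N] self(2)[OF that] that
      by (auto simp: finite_index_normal_def normal_imp_subgroup)
    then show ?thesis by (metis DiffD1)
  qed
  also have "\<dots> \<longleftrightarrow> H = \<Inter> {H <#> N |N. finite_index_normal G N}"
  proof -
    have "H \<subseteq> H <#> N" if "finite_index_normal G N" for N
    proof
      fix x assume x: "x \<in> H"
      then have "x \<in> carrier G" using HG by auto
      then show "x \<in> H <#> N" using mem[OF that] self(1)[OF that] x by blast
    qed
    then have 1: "H \<subseteq> \<Inter> {H <#> N |N. finite_index_normal G N}" by blast
    have "finite_index_normal G (carrier G)"
      using coset_join2[OF _ subgroup_self] normal_self
      by (auto simp: finite_index_normal_def RCOSETS_def)
    moreover have "H <#> carrier G \<subseteq> carrier G"
      using HG by (auto simp: set_mult_def)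
    ultimately have 2: "\<Inter> {H <#> N |N. finite_index_normal G N} \<subseteq> carrier G" by blast
    have "x \<in> \<Inter> {H <#> N |N. finite_index_normal G N} \<longleftrightarrow>
        (\<forall>N. finite_index_normal G N \<longrightarrow> x \<in> H <#> N)" for x by blast
    then show ?thesis
      using 1 2 unfolding set_eq_iff subset_iff Ball_def Diff_iff by meson
  qed
  finally show ?thesis .
qed

end

theory Submission
  imports Defs "HOL-Algebra.Bij" "HOL-Algebra.Zassenhaus"
begin

text \<open>Let \<open>\<theta>\<close> and \<open>\<eta>\<close> be the two projections of \<open>H\<close> to the free factors. If one of them is injective on
  \<open>H\<close>, then \<open>H\<close> is the graph of a homomorphism from a finitely generated subgroup of a free group, and
  residual finiteness of the other factor separates a given point from \<open>H\<close> by a larger subgroup that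
  contains a product of finite index subgroups; the latter is separable by Marshall Hall's theorem.

  Otherwise \<open>L1 = \<theta> (ker \<eta>)\<close> and \<open>L2 = \<eta> (ker \<theta>)\<close> are nontrivial, and both have finite index in the
  projections of \<open>H\<close>, so Hall's theorem applies again. To see this, take a Fox derivative \<open>\<delta>\<close> on the
  first factor and \<open>t \<in> L1\<close> such that the coefficients of \<open>\<delta> t\<close> over \<open>L1\<close> sum to \<open>1\<close>, and let
  \<open>\<tau> \<in> ker \<eta>\<close> lie over \<open>t\<close>. Lift \<open>\<delta> \<circ> \<theta>\<close> to a derivation on the free group of a presentation of \<open>H\<close>
  with values in finitely supported chains on \<open>H\<close>. As there are finitely many relators, it descends to
  \<open>H\<close> after summing over the cosets of a suitable \<open>K0 = \<langle>ker \<eta>, finite set\<rangle>\<close> inside \<open>K = (ker \<theta>) (ker \<eta>)\<close>.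
  Its value at \<open>\<tau>\<close> is then invariant under \<open>ker \<theta>\<close>, because \<open>\<tau>\<close> commutes with \<open>ker \<theta>\<close>; being finitely
  supported and nonzero on \<open>K\<close>, it forces \<open>K0\<close> to have finite index in \<open>K\<close>, so \<open>L2\<close> is finitely
  generated. A similar count shows that a nontrivial finitely generated normal subgroup of a free group
  has finite index.\<close>

section \<open>Sums over cosets\<close>

text \<open>\<open>sum'\<close> adds over the support inside the index set and defaults to
  \<open>0\<close> when that support is infinite. The bijection matches the two supports, so finite
  sums agree and infinite supports give the default on both sides.\<close>

lemma sum'_bij_betw:
  assumes \<sigma>: "bij_betw \<sigma> C C'" and f: "\<And>x. x \<in> C \<Longrightarrow> f x = f' (\<sigma> x)"
  shows "sum' f C = sum' f' C'"
proof -
  have b: "bij_betw \<sigma> {x \<in> C. f x \<noteq> 0} {x \<in> C'. f' x \<noteq> 0}"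
    using \<sigma> f unfolding bij_betw_def by (auto simp: inj_on_def)
  have "sum f {x \<in> C. f x \<noteq> 0} = sum (\<lambda>x. f' (\<sigma> x)) {x \<in> C. f x \<noteq> 0}"
    using f by (intro sum.cong) auto
  then show ?thesis
    using sum.reindex_bij_betw[OF b, of f'] bij_betw_finite[OF b] by (simp add: sum.G_def)
qed

lemma sum'_nonzeroE:
  assumes "sum' f C \<noteq> 0"
  obtains x where "x \<in> C" "f x \<noteq> 0"
  using assms unfolding sum.G_def by (metis (mono_tags, lifting) mem_Collect_eq sum.neutral)

lemma (in group) mem_l_coset_iff:
  assumes "subgroup K G" "g \<in> carrier G"
  shows "x \<in> g <# K \<longleftrightarrow> x \<in> carrier G \<and> inv g \<otimes> x \<in> K"
  using assms l_coset_carrier subgroup.lcos_module_rev[OF assms(1) is_group]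
  by (auto simp: l_coset_def m_assoc[symmetric] subgroup.mem_carrier)

lemma (in group) l_coset_self: "subgroup K G \<Longrightarrow> g \<in> carrier G \<Longrightarrow> g \<in> g <# K"
  by (simp add: mem_l_coset_iff subgroup.one_closed)

lemma (in group) l_coset_eq_iff:
  assumes "subgroup K G" "g \<in> carrier G" "h \<in> carrier G"
  shows "g <# K = h <# K \<longleftrightarrow> inv g \<otimes> h \<in> K"
  using assms l_repr_independence mem_l_coset_iff l_coset_self by metis

lemma (in group) bij_betw_l_coset:
  assumes "K \<subseteq> carrier G" "g \<in> carrier G" "h \<in> carrier G"
  shows "bij_betw ((\<otimes>) h) (g <# K) ((h \<otimes> g) <# K)"
proof -
  have "(\<otimes>) h ` (g <# K) = (h \<otimes> g) <# K"
    using assms by (force simp: l_coset_def m_assoc image_iff)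
  moreover have "inj_on ((\<otimes>) h) (g <# K)"
    using assms l_coset_subset_G[OF assms(1,2)] by (auto simp: inj_on_def subset_iff)
  ultimately show ?thesis by (simp add: bij_betw_def)
qed

section \<open>Chain-valued derivations\<close>

text \<open>A derivation into the chains on \<open>G\<close>, a chain being the function of its integer coefficients;
  \<open>F\<close> acts on chains by left translation through \<open>\<pi>\<close>.\<close>

locale derivation = group_hom F G \<pi>
  for F :: "('u, 'k) monoid_scheme" and G :: "('g, 'l) monoid_scheme" and \<pi> +
  fixes D :: "'u \<Rightarrow> 'g \<Rightarrow> int"
  assumes D_mult: "\<lbrakk>u \<in> carrier F; v \<in> carrier F; g \<in> carrier G\<rbrakk>
    \<Longrightarrow> D (u \<otimes>\<^bsub>F\<^esub> v) g = D u g + D v (inv\<^bsub>G\<^esub> \<pi> u \<otimes>\<^bsub>G\<^esub> g)"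
begin

lemma D_one: "g \<in> carrier G \<Longrightarrow> D \<one>\<^bsub>F\<^esub> g = 0"
  using D_mult[of "\<one>\<^bsub>F\<^esub>" "\<one>\<^bsub>F\<^esub>" g] by simp

lemma D_inv:
  assumes "u \<in> carrier F" "g \<in> carrier G"
  shows "D (inv\<^bsub>F\<^esub> u) g = - D u (\<pi> u \<otimes>\<^bsub>G\<^esub> g)"
  using D_mult[of "inv\<^bsub>F\<^esub> u" u g] assms by (simp add: D_one)

text \<open>Pushing chains forward to the left cosets of \<open>K\<close> preserves the Leibniz
  rule, as left translation permutes these cosets. A chain on cosets is encoded as a function on
  \<open>G\<close> constant along them; finite supports make \<open>sum'\<close> additive.\<close>

lemma sum_l_cosets:
  assumes K: "subgroup K G"
    and fin: "\<And>u. u \<in> carrier F \<Longrightarrow> finite {g \<in> carrier G. D u g \<noteq> 0}"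
  shows "derivation F G \<pi> (\<lambda>u g. sum' (D u) (g <#\<^bsub>G\<^esub> K))"
proof unfold_locales
  fix u v g assume u: "u \<in> carrier F" and v: "v \<in> carrier F" and g: "g \<in> carrier G"
  let ?h = "\<lambda>q. inv\<^bsub>G\<^esub> \<pi> u \<otimes>\<^bsub>G\<^esub> q"
  have KG: "K \<subseteq> carrier G" using K by (rule subgroup.subset)
  have sub: "q \<in> carrier G" if "q \<in> g <#\<^bsub>G\<^esub> K" for q
    using that g K by (rule H.l_coset_carrier)
  have f1: "finite {q \<in> g <#\<^bsub>G\<^esub> K. D u q \<noteq> 0}"
    by (rule finite_subset[OF _ fin[OF u]]) (auto dest: sub)
  have "inj_on ?h (carrier G)" using u by (auto simp: inj_on_def)
  then have "finite {q \<in> carrier G. D v (?h q) \<noteq> 0}"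
    by (intro inj_on_finite[OF _ _ fin[OF v], of ?h]) (use u in \<open>auto simp: inj_on_def\<close>)
  then have f2: "finite {q \<in> g <#\<^bsub>G\<^esub> K. D v (?h q) \<noteq> 0}"
    by (rule finite_subset[rotated]) (auto dest: sub)
  have "sum' (D (u \<otimes>\<^bsub>F\<^esub> v)) (g <#\<^bsub>G\<^esub> K) = sum' (\<lambda>q. D u q + D v (?h q)) (g <#\<^bsub>G\<^esub> K)"
    by (rule sum.cong') (auto simp: D_mult u v sub)
  also have "\<dots> = sum' (D u) (g <#\<^bsub>G\<^esub> K) + sum' (\<lambda>q. D v (?h q)) (g <#\<^bsub>G\<^esub> K)"
    by (rule sum.distrib'[OF f1 f2])
  also have "sum' (\<lambda>q. D v (?h q)) (g <#\<^bsub>G\<^esub> K) = sum' (D v) (?h g <#\<^bsub>G\<^esub> K)"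
    by (rule sum'_bij_betw[OF H.bij_betw_l_coset[OF KG g]]) (use u in auto)
  finally show "sum' (D (u \<otimes>\<^bsub>F\<^esub> v)) (g <#\<^bsub>G\<^esub> K) =
    sum' (D u) (g <#\<^bsub>G\<^esub> K) + sum' (D v) (?h g <#\<^bsub>G\<^esub> K)" .
qed

text \<open>The elements of the kernel of \<open>\<pi>\<close> with zero derivative form a normal
  subgroup \<open>N\<close>: when \<open>D\<close> is expanded at the conjugate of \<open>h\<close>
  by \<open>x\<close>, the term of \<open>h\<close> vanishes, and those of \<open>x\<close> and its
  inverse cancel because \<open>h\<close> acts trivially.\<close>

lemma D_normal_closure:
  assumes R: "R \<subseteq> carrier F" "\<And>r. r \<in> R \<Longrightarrow> \<pi> r = \<one>\<^bsub>G\<^esub>"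
    and 0: "\<And>r g. r \<in> R \<Longrightarrow> g \<in> carrier G \<Longrightarrow> D r g = 0"
    and u: "u \<in> normal_closure F R" and g: "g \<in> carrier G"
  shows "D u g = 0"
proof -
  define N where "N = {u \<in> carrier F. \<pi> u = \<one>\<^bsub>G\<^esub> \<and> (\<forall>g\<in>carrier G. D u g = 0)}"
  have "N \<lhd> F"
  proof (rule G.normal_invI)
    show "subgroup N F"
      by (rule G.subgroupI) (auto simp: N_def D_one D_inv D_mult intro: exI[of _ "\<one>\<^bsub>F\<^esub>"])
    fix x h assume x: "x \<in> carrier F" and h: "h \<in> N"
    have "D (x \<otimes>\<^bsub>F\<^esub> h \<otimes>\<^bsub>F\<^esub> inv\<^bsub>F\<^esub> x) g = 0" if "g \<in> carrier G" for g
      using x h that by (simp add: N_def D_mult D_inv H.m_assoc[symmetric])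
    then show "x \<otimes>\<^bsub>F\<^esub> h \<otimes>\<^bsub>F\<^esub> inv\<^bsub>F\<^esub> x \<in> N"
      using x h by (simp add: N_def)
  qed
  moreover have "R \<subseteq> N" using R 0 by (auto simp: N_def)
  ultimately show ?thesis using u g by (auto simp: normal_closure_def N_def)
qed

end

section \<open>Fox derivatives\<close>

lemma letter_closed: "fst a \<in> X \<Longrightarrow> [a] \<in> carrier (free_group X)"
  by (simp add: carrier_free_group)

lemma inv_letter:
  assumes "fst a \<in> X" shows "inv\<^bsub>free_group X\<^esub> [a] = [flip_letter a]"
proof -
  interpret group "free_group X" by (rule group_free_group)
  show ?thesis
    by (rule inv_equality) (use assms in \<open>auto simp: letter_closed mult_free_group one_free_group\<close>)
qed

lemma free_group_ConsD:
  assumes "a # w \<in> carrier (free_group X)"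
  shows "fst a \<in> X" "w \<in> carrier (free_group X)" "a # w = [a] \<otimes>\<^bsub>free_group X\<^esub> w"
  using assms by (auto simp: carrier_free_group mult_free_group push_eq_Cons dest: reduced_ConsD)

text \<open>The Leibniz rule reduces words to letters, and \<open>D_inv\<close> reduces inverse
  letters to generators. Applied to a difference, this shows that derivations that agree on the free
  generators are equal.\<close>

lemma free_derivation_eq_0:
  assumes "derivation (free_group X) G \<pi> D"
    and 0: "\<And>x g. x \<in> X \<Longrightarrow> g \<in> carrier G \<Longrightarrow> D [(x, True)] g = 0"
    and "w \<in> carrier (free_group X)" "g \<in> carrier G"
  shows "D w g = 0"
proof -
  interpret derivation "free_group X" G \<pi> D by fact
  have letter: "D [a] g = 0" if "fst a \<in> X" "g \<in> carrier G" for a g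
  proof -
    obtain x b where a: "a = (x, b)" by (cases a)
    have "D (inv\<^bsub>free_group X\<^esub> [(x, True)]) g = 0"
      using that a by (subst D_inv) (auto simp: 0 letter_closed)
    then show ?thesis using that a 0 by (cases b) (auto simp: inv_letter)
  qed
  show ?thesis
    using assms(3,4)
  proof (induction w arbitrary: g)
    case Nil
    then show ?case using D_one by (simp add: one_free_group)
  next
    case (Cons a w)
    note a = free_group_ConsD[OF Cons.prems(1)]
    show ?case
      unfolding a(3) using a(1,2) Cons.prems(2) Cons.IH[OF a(2)] letter
      by (subst D_mult) (auto simp: letter_closed)
  qed
qed

fun fox_sum :: "('g, 'm) monoid_scheme \<Rightarrow> ('l \<Rightarrow> 'g) \<Rightarrow> ('l \<Rightarrow> 'g \<Rightarrow> int) \<Rightarrow> 'l list \<Rightarrow> 'g \<Rightarrow> int" where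
  "fox_sum G l c [] g = 0"
| "fox_sum G l c (a # w) g = c a g + fox_sum G l c w (inv\<^bsub>G\<^esub> l a \<otimes>\<^bsub>G\<^esub> g)"

text \<open>Values at free generators can be prescribed at will. Only cancellation has to be
  respected, and the values at inverse letters are chosen so that two adjacent inverse letters
  contribute zero in total.\<close>

lemma free_derivation_exists:
  assumes "group G" and "\<pi> \<in> hom (free_group X) G"
    and c: "\<And>x. x \<in> X \<Longrightarrow> finite {g \<in> carrier G. c x g \<noteq> 0}"
  obtains D where "derivation (free_group X) G \<pi> D"
    and "\<And>x g. x \<in> X \<Longrightarrow> g \<in> carrier G \<Longrightarrow> D [(x, True)] g = c x g"
    and "\<And>w. w \<in> carrier (free_group X) \<Longrightarrow> finite {g \<in> carrier G. D w g \<noteq> 0}"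
proof -
  interpret group_hom "free_group X" G \<pi>
    using assms by (simp add: group_hom_def group_hom_axioms_def group_free_group)
  define l where "l a = \<pi> [a]" for a
  \<comment> \<open>The value at an inverse letter is the one that \<open>D_inv\<close>
    forces.\<close>
  define d where "d a g = (if snd a then c (fst a) g else - c (fst a) (l (flip_letter a) \<otimes>\<^bsub>G\<^esub> g))" for a g
  have l: "l a \<in> carrier G" if "fst a \<in> X" for a
    using that by (simp add: l_def letter_closed)
  have l_flip: "l (flip_letter a) = inv\<^bsub>G\<^esub> l a" if "fst a \<in> X" for a
    using hom_inv[OF letter_closed[OF that]] that by (simp add: l_def inv_letter)
  have d_flip: "d (flip_letter a) g = - d a (l a \<otimes>\<^bsub>G\<^esub> g)" if "fst a \<in> X" "g \<in> carrier G" for a g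
  proof (cases "snd a")
    case False
    have "l (flip_letter a) \<otimes>\<^bsub>G\<^esub> (l a \<otimes>\<^bsub>G\<^esub> g) = g"
      using that l[of a] by (simp add: l_flip H.m_assoc[symmetric])
    then show ?thesis using False by (cases a) (simp add: d_def)
  qed (cases a, simp add: d_def)
  define D where "D = fox_sum G l d"
  \<comment> \<open>If the pushed letter cancels the head of \<open>w\<close>, the contributions of
    the two letters cancel by \<open>d_flip\<close>.\<close>
  have D_push: "D (push_letter a w) g = d a g + D w (inv\<^bsub>G\<^esub> l a \<otimes>\<^bsub>G\<^esub> g)"
    if "fst a \<in> X" "fst ` set w \<subseteq> X" "g \<in> carrier G" for a w g
    using that l[of a]
    by (cases w) (auto simp: D_def d_flip l_flip H.m_assoc[symmetric])
  have \<pi>: "\<pi> (a # w) = l a \<otimes>\<^bsub>G\<^esub> \<pi> w" if "a # w \<in> carrier (free_group X)" for a w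
    using free_group_ConsD[OF that] by (metis hom_mult l_def letter_closed)
  have D_mult: "D (foldr push_letter u v) g = D u g + D v (inv\<^bsub>G\<^esub> \<pi> u \<otimes>\<^bsub>G\<^esub> g)"
    if "u \<in> carrier (free_group X)" "v \<in> carrier (free_group X)" "g \<in> carrier G" for u v g
    using that(1,3)
  proof (induction u arbitrary: g)
    case Nil
    then show ?case using hom_one by (simp add: D_def one_free_group)
  next
    case (Cons a u)
    note a = free_group_ConsD[OF Cons.prems(1)]
    have "fst ` set (foldr push_letter u v) \<subseteq> X"
      using subset_trans[OF letters_mult[of u v] Un_least[of _ X]] a(2) that(2)
      by (simp add: carrier_free_group)
    then show ?case
      using D_push[of a "foldr push_letter u v" g] Cons a(1,2) l[of a]
      by (simp add: \<pi> H.inv_mult_group H.m_assoc) (simp add: D_def)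
  qed
  have d: "finite {g \<in> carrier G. d a g \<noteq> 0}" if a: "fst a \<in> X" for a
  proof (cases "snd a")
    case False
    have "finite {g \<in> carrier G. c (fst a) (l (flip_letter a) \<otimes>\<^bsub>G\<^esub> g) \<noteq> 0}"
      by (rule inj_on_finite[OF _ _ c[OF a], of "\<lambda>g. l (flip_letter a) \<otimes>\<^bsub>G\<^esub> g"])
        (use a l[of "flip_letter a"] in \<open>auto simp: inj_on_def\<close>)
    then show ?thesis using False by (simp add: d_def)
  qed (use c[OF a] in \<open>simp add: d_def\<close>)
  show thesis
  proof
    show "derivation (free_group X) G \<pi> D"
      by unfold_locales (simp add: mult_free_group D_mult)
    show "D [(x, True)] g = c x g" if "x \<in> X" "g \<in> carrier G" for x g
      using that by (simp add: D_def d_def)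
    show "finite {g \<in> carrier G. D w g \<noteq> 0}" if "w \<in> carrier (free_group X)" for w
      using that
    proof (induction w)
      case Nil
      then show ?case by (simp add: D_def)
    next
      case (Cons a w)
      note a = free_group_ConsD[OF Cons.prems(1)]
      have "finite {g \<in> carrier G. D w (inv\<^bsub>G\<^esub> l a \<otimes>\<^bsub>G\<^esub> g) \<noteq> 0}"
        by (rule inj_on_finite[OF _ _ Cons.IH[OF a(2)], of "\<lambda>g. inv\<^bsub>G\<^esub> l a \<otimes>\<^bsub>G\<^esub> g"])
          (use l[OF a(1)] in \<open>auto simp: inj_on_def\<close>)
      with d[OF a(1)]
      have "finite ({g \<in> carrier G. d a g \<noteq> 0} \<union> {g \<in> carrier G. D w (inv\<^bsub>G\<^esub> l a \<otimes>\<^bsub>G\<^esub> g) \<noteq> 0})"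
        by simp
      then show ?case by (rule finite_subset[rotated]) (auto simp: D_def)
    qed
  qed
qed

lemma foldr_push_letter_append: "reduced (u @ v) \<Longrightarrow> foldr push_letter u v = u @ v"
proof (induction u)
  case (Cons a u)
  then show ?case using push_eq_Cons[of a "u @ v"] by (auto dest: reduced_ConsD)
qed simp

lemma reduced_appendD: "reduced (u @ v) \<Longrightarrow> reduced u \<and> reduced v"
  by (induction u rule: reduced.induct) (auto dest: reduced_ConsD)

lemma flip_letter_neq [simp]: "flip_letter a \<noteq> a" "a \<noteq> flip_letter a"
  by (cases a; auto)+

lemma push_letter_eq_Nil_iff: "reduced p \<Longrightarrow> push_letter a p = [] \<longleftrightarrow> p = [flip_letter a]"
  by (cases p) auto

lemma push_letter_eq_singleton_iff: "reduced p \<Longrightarrow> push_letter a p = [a] \<longleftrightarrow> p = []"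
  by (cases p rule: reduced.cases) auto

text \<open>This is the Fox derivative with respect to \<open>a0\<close>, taken as a free generator
  even if it is an inverse letter. An occurrence of \<open>a0\<close> in \<open>w\<close>
  contributes \<open>1\<close> at the prefix before it, an occurrence of its inverse contributes
  \<open>-1\<close> at the prefix ending with it; the listed properties reflect this.\<close>

lemma fox_derivative_exists:
  assumes a0: "fst a0 \<in> X"
  obtains D where "derivation (free_group X) (free_group X) (\<lambda>w. w) D"
    and "\<And>w. w \<in> carrier (free_group X) \<Longrightarrow> finite {p \<in> carrier (free_group X). D w p \<noteq> 0}"
    and "\<And>w p. \<lbrakk>w \<in> carrier (free_group X); p \<in> carrier (free_group X); D w p \<noteq> 0\<rbrakk> \<Longrightarrow> \<exists>s. w = p @ s"
    and "\<And>w. w \<in> carrier (free_group X) \<Longrightarrow> w \<noteq> [] \<Longrightarrow> last w \<noteq> flip_letter a0 \<Longrightarrow> D w w = 0"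
    and "\<And>w. a0 # w \<in> carrier (free_group X) \<Longrightarrow> D (a0 # w) [] = 1"
proof -
  \<comment> \<open>For an inverse letter \<open>a0\<close>, the generator gets the coefficient
    \<open>-1\<close> at itself, so that \<open>a0\<close> gets the coefficient \<open>1\<close> at
    the empty word.\<close>
  define c :: "'a \<Rightarrow> ('a \<times> bool) list \<Rightarrow> int" where "c x p = (if x = fst a0 then if snd a0 then of_bool (p = [])
    else - of_bool (p = [(x, True)]) else 0)" for x p
  interpret group "free_group X" by (rule group_free_group)
  have id_hom: "(\<lambda>w. w) \<in> hom (free_group X) (free_group X)" by (simp add: hom_def)
  have c_fin: "finite {g \<in> carrier (free_group X). c x g \<noteq> 0}" for x
    by (rule finite_subset[of _ "{[], [(x, True)]}"]) (auto simp: c_def split: if_splits)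
  obtain D where D: "derivation (free_group X) (free_group X) (\<lambda>w. w) D"
    and D_gen: "\<And>x g. x \<in> X \<Longrightarrow> g \<in> carrier (free_group X) \<Longrightarrow> D [(x, True)] g = c x g"
    and fin: "\<And>w. w \<in> carrier (free_group X) \<Longrightarrow> finite {g \<in> carrier (free_group X). D w g \<noteq> 0}"
    by (rule free_derivation_exists[where c = c, OF group_free_group id_hom c_fin that])
  note D_mult = derivation.D_mult[OF D] and D_inv = derivation.D_inv[OF D] and D_one = derivation.D_one[OF D]
  have push_closed: "push_letter a p \<in> carrier (free_group X)"
    if "fst a \<in> X" "p \<in> carrier (free_group X)" for a p
    using m_closed[OF letter_closed[OF that(1)] that(2)] by (simp add: mult_free_group)
  have letter: "D [a] p = (if a = a0 then of_bool (p = [])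
      else if a = flip_letter a0 then - of_bool (p = [flip_letter a0]) else 0)"
    if a: "fst a \<in> X" and p: "p \<in> carrier (free_group X)" for a p
  proof -
    obtain x b where ab: "a = (x, b)" by (cases a)
    obtain y e where a0: "a0 = (y, e)" by (cases a0)
    have x: "x \<in> X" using a ab by simp
    have red: "reduced p" using p by (simp add: carrier_free_group)
    show ?thesis
    proof (cases b)
      case True
      then show ?thesis using D_gen[OF x p] by (auto simp: ab a0 c_def)
    next
      case False
      have "D [a] p = - c x (push_letter (x, True) p)"
        using D_inv[of "[(x, True)]" p] D_gen[OF x push_closed[of "(x, True)"]] x p False ab
        by (simp add: letter_closed inv_letter mult_free_group)
      then show ?thesis
        using False push_letter_eq_Nil_iff[OF red, of "(x, True)"]
          push_letter_eq_singleton_iff[OF red, of "(x, True)"]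
        by (auto simp: ab a0 c_def)
    qed
  qed
  have step: "D (a # w) p = D [a] p + D w (push_letter (flip_letter a) p)"
    if "a # w \<in> carrier (free_group X)" "p \<in> carrier (free_group X)" for a w p
    using free_group_ConsD[OF that(1)] that(2) D_mult[of "[a]" w p]
    by (simp add: letter_closed inv_letter mult_free_group)
  have prefix: "\<exists>s. w = p @ s"
    if "w \<in> carrier (free_group X)" "p \<in> carrier (free_group X)" "D w p \<noteq> 0" for w p
    using that
  proof (induction w arbitrary: p)
    case Nil
    then show ?case using D_one by (simp add: one_free_group)
  next
    case (Cons a w)
    note a = free_group_ConsD[OF Cons.prems(1)]
    let ?q = "push_letter (flip_letter a) p"
    consider "D [a] p \<noteq> 0" | "D w ?q \<noteq> 0"
      using Cons.prems step by fastforce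
    then show ?case
    proof cases
      case 1
      then show ?thesis using letter[OF a(1) Cons.prems(2)] by (auto split: if_splits)
    next
      case 2
      obtain s where s: "w = ?q @ s"
        using Cons.IH[OF a(2) push_closed 2] a(1) Cons.prems(2) by auto
      \<comment> \<open>Since \<open>a # w\<close> is reduced, \<open>a\<close> does not cancel
        against the prefix \<open>?q\<close> of \<open>w\<close>; translating back only prepends
        \<open>a\<close>.\<close>
      have "reduced (a # ?q)"
        using Cons.prems(1) reduced_appendD[of "a # ?q" s] s by (simp add: carrier_free_group)
      then have "p = a # ?q"
        using push_eq_Cons[of a ?q] push_push_flip[of p a] Cons.prems(2)
        by (simp add: carrier_free_group)
      then show ?thesis using s by (metis append_Cons)
    qed
  qed
  have diag: "D w w = 0"
    if "w \<in> carrier (free_group X)" "w \<noteq> []" "last w \<noteq> flip_letter a0" for w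
    using that
  proof (induction w)
    case (Cons a w)
    note a = free_group_ConsD[OF Cons.prems(1)]
    have "D (a # w) (a # w) = D [a] (a # w) + D w w"
      using step[OF Cons.prems(1,1)] by simp
    then show ?case
      using Cons letter[OF a(1) Cons.prems(1)] a(2) D_one
      by (cases "w = []") (auto simp: one_free_group)
  qed simp
  have start: "D (a0 # w) [] = 1" if w: "a0 # w \<in> carrier (free_group X)" for w
  proof -
    have c: "[] \<in> carrier (free_group X)" "[flip_letter a0] \<in> carrier (free_group X)"
      using a0 by (auto simp: carrier_free_group)
    \<comment> \<open>Otherwise \<open>w\<close> would begin with \<open>flip_letter a0\<close>,
      although \<open>a0 # w\<close> is reduced.\<close>
    have "D w [flip_letter a0] = 0"
      using prefix[OF free_group_ConsD(2)[OF w] c(2)] w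
      by (cases "D w [flip_letter a0] = 0") (auto simp: carrier_free_group)
    then show ?thesis using step[OF w c(1)] letter[OF a0 c(1)] by simp
  qed
  show thesis using that D fin prefix diag start by blast
qed

section \<open>Conjugation, and a derivation adapted to a subgroup\<close>

lemma (in group) conj_mult:
  assumes "g \<in> carrier G" "x \<in> carrier G" "y \<in> carrier G"
  shows "g \<otimes> (x \<otimes> y) \<otimes> inv g = (g \<otimes> x \<otimes> inv g) \<otimes> (g \<otimes> y \<otimes> inv g)"
proof -
  have "inv g \<otimes> (g \<otimes> z) = z" if "z \<in> carrier G" for z
    using assms(1) that by (simp add: m_assoc[symmetric])
  then show ?thesis using assms by (simp add: m_assoc)
qed

lemma (in group) conj_inv:
  assumes "g \<in> carrier G" "x \<in> carrier G"
  shows "inv (g \<otimes> x \<otimes> inv g) = g \<otimes> inv x \<otimes> inv g"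
  using assms by (simp add: inv_mult_group m_assoc)

lemma (in group) inj_on_conj: "g \<in> carrier G \<Longrightarrow> inj_on (\<lambda>x. g \<otimes> x \<otimes> inv g) (carrier G)"
  by (auto simp: inj_on_def)

lemma (in group) conj_inv_conj:
  assumes "g \<in> carrier G" "x \<in> carrier G"
  shows "g \<otimes> (inv g \<otimes> x \<otimes> g) \<otimes> inv g = x" "inv g \<otimes> (g \<otimes> x \<otimes> inv g) \<otimes> g = x"
  using assms by (simp_all add: m_assoc) (simp_all add: m_assoc[symmetric])

text \<open>Take a shortest nontrivial word among all conjugates of \<open>L\<close>. A nonempty
  proper prefix in the same conjugate would be shorter, and cyclic reduction keeps the word itself
  out of the support. So its Fox derivative at the first letter meets the conjugate only in the
  identity, with coefficient \<open>1\<close>. Conjugation moves this back to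
  \<open>L\<close>.\<close>

lemma subgroup_derivation_exists:
  assumes L: "subgroup L (free_group X)" and nontriv: "L \<noteq> {\<one>\<^bsub>free_group X\<^esub>}"
  obtains \<delta> t where "derivation (free_group X) (free_group X) (\<lambda>w. w) \<delta>"
    and "\<And>w. w \<in> carrier (free_group X) \<Longrightarrow> finite {p \<in> carrier (free_group X). \<delta> w p \<noteq> 0}"
    and "t \<in> L" and "sum' (\<delta> t) L = 1"
proof -
  define F where "F = free_group X"
  interpret group F unfolding F_def by (rule group_free_group)
  have LF: "L \<subseteq> carrier F" using L subgroup.subset by (auto simp: F_def)
  define P where "P = (\<lambda>(g, t). g \<in> carrier F \<and> t \<in> carrier F \<and> t \<noteq> [] \<and> inv\<^bsub>F\<^esub> g \<otimes>\<^bsub>F\<^esub> t \<otimes>\<^bsub>F\<^esub> g \<in> L)"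
  obtain w where w: "w \<in> L" "w \<noteq> []"
    using nontriv subgroup.one_closed[OF L] by (auto simp: one_free_group)
  have "P (\<one>\<^bsub>F\<^esub>, w)" using w LF by (auto simp: P_def)
  then obtain g t where gt: "P (g, t)" and min: "\<And>g' t'. P (g', t') \<Longrightarrow> length t \<le> length t'"
    using ex_has_least_nat[of P _ "\<lambda>(g, t). length t"] by fastforce
  have g: "g \<in> carrier F" and t: "t \<in> carrier F" "t \<noteq> []" and tL: "inv\<^bsub>F\<^esub> g \<otimes>\<^bsub>F\<^esub> t \<otimes>\<^bsub>F\<^esub> g \<in> L"
    using gt by (auto simp: P_def)
  obtain a0 t' where t': "t = a0 # t'" using t(2) by (cases t) auto
  have a0: "fst a0 \<in> X" using t t' by (simp add: F_def carrier_free_group)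
  have a0F: "[a0] \<in> carrier F" "inv\<^bsub>F\<^esub> [a0] = [flip_letter a0]"
    using a0 by (auto simp: F_def letter_closed inv_letter)
  \<comment> \<open>A conjugate of minimal length is cyclically reduced.\<close>
  have last: "last t \<noteq> flip_letter a0"
  proof
    assume last: "last t = flip_letter a0"
    then have "t' \<noteq> []" using t' by auto
    then obtain w where w: "t' = w @ [flip_letter a0]"
      using last t' by (metis append_butlast_last_id last_ConsR)
    have "reduced (a0 # w @ [flip_letter a0])" using t t' w by (simp add: F_def carrier_free_group)
    then have red: "reduced (a0 # w)" "reduced (w @ [flip_letter a0])" and ne: "w \<noteq> []"
      using reduced_appendD[of "a0 # w"] by (auto dest: reduced_ConsD)
    have wF: "w \<in> carrier F"
      using red t t' w by (auto simp: F_def carrier_free_group dest: reduced_ConsD)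
    have "t = [a0] \<otimes>\<^bsub>F\<^esub> (w \<otimes>\<^bsub>F\<^esub> inv\<^bsub>F\<^esub> [a0])"
      using t t' w red(2) a0F push_eq_Cons[of a0 "w @ [flip_letter a0]"]
      by (simp add: F_def mult_free_group carrier_free_group foldr_push_letter_append)
    then have "inv\<^bsub>F\<^esub> (inv\<^bsub>F\<^esub> [a0] \<otimes>\<^bsub>F\<^esub> g) \<otimes>\<^bsub>F\<^esub> w \<otimes>\<^bsub>F\<^esub> (inv\<^bsub>F\<^esub> [a0] \<otimes>\<^bsub>F\<^esub> g) = inv\<^bsub>F\<^esub> g \<otimes>\<^bsub>F\<^esub> t \<otimes>\<^bsub>F\<^esub> g"
      using g wF a0F(1) by (simp add: inv_mult_group m_assoc)
    then have "P (inv\<^bsub>F\<^esub> [a0] \<otimes>\<^bsub>F\<^esub> g, w)" using g wF a0F(1) tL ne by (simp add: P_def)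
    then show False using min t' w by fastforce
  qed
  obtain D where D: "derivation F F (\<lambda>w. w) D"
    and fin: "\<And>w. w \<in> carrier F \<Longrightarrow> finite {p \<in> carrier F. D w p \<noteq> 0}"
    and prefix: "\<And>w p. \<lbrakk>w \<in> carrier F; p \<in> carrier F; D w p \<noteq> 0\<rbrakk> \<Longrightarrow> \<exists>s. w = p @ s"
    and diag: "\<And>w. \<lbrakk>w \<in> carrier F; w \<noteq> []; last w \<noteq> flip_letter a0\<rbrakk> \<Longrightarrow> D w w = 0"
    and start: "\<And>w. a0 # w \<in> carrier F \<Longrightarrow> D (a0 # w) [] = 1"
    using fox_derivative_exists[OF a0, folded F_def] by blast
  have Dtt: "D t t = 0" using diag[OF t last] .
  have Dt1: "D t [] = 1" using start t(1) t' by simp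
  define k where "k x = g \<otimes>\<^bsub>F\<^esub> x \<otimes>\<^bsub>F\<^esub> inv\<^bsub>F\<^esub> g" for x
  have k: "k x \<in> carrier F" if "x \<in> carrier F" for x using that g by (simp add: k_def)
  have k_mult: "k (x \<otimes>\<^bsub>F\<^esub> y) = k x \<otimes>\<^bsub>F\<^esub> k y" if "x \<in> carrier F" "y \<in> carrier F" for x y
    using conj_mult[OF g that] by (simp add: k_def)
  have k_inv: "k (inv\<^bsub>F\<^esub> x) = inv\<^bsub>F\<^esub> k x" if "x \<in> carrier F" for x
    using conj_inv[OF g that] by (simp add: k_def)
  \<comment> \<open>Transport of \<open>D\<close> through the conjugation \<open>k\<close> in both
    arguments; coefficients on \<open>L\<close> become those of \<open>D\<close> on the conjugate of
    \<open>L\<close>.\<close>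
  define \<delta> where "\<delta> w p = D (k w) (k p)" for w p
  define t0 where "t0 = inv\<^bsub>F\<^esub> g \<otimes>\<^bsub>F\<^esub> t \<otimes>\<^bsub>F\<^esub> g"
  have kt0: "k t0 = t" using g t by (simp add: k_def t0_def conj_inv_conj)
  \<comment> \<open>Such a point of the support would become under \<open>k\<close> a nonempty
    prefix of \<open>t\<close> in the conjugate, hence all of \<open>t\<close> by minimality, where
    \<open>D t\<close> vanishes.\<close>
  have \<delta>0: "\<delta> t0 q = 0" if q: "q \<in> L - {\<one>\<^bsub>F\<^esub>}" for q
  proof (rule ccontr)
    assume "\<delta> t0 q \<noteq> 0"
    have qF: "q \<in> carrier F" using q LF by auto
    obtain s where s: "t = k q @ s"
      using \<open>\<delta> t0 q \<noteq> 0\<close> prefix[OF t(1) k[OF qF]] kt0 by (auto simp: \<delta>_def)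
    have "k q \<noteq> []"
      using q qF inj_on_conj[OF g] g unfolding k_def inj_on_def
      by (metis DiffD2 F_def inv_closed m_closed one_closed one_free_group r_inv r_one singletonI)
    then have "P (g, k q)"
      using q qF g k conj_inv_conj(2)[OF g qF] by (simp add: P_def k_def)
    then have "k q = t" using min[of g "k q"] s by simp
    then show False using \<open>\<delta> t0 q \<noteq> 0\<close> Dtt kt0 by (simp add: \<delta>_def)
  qed
  have k1: "k \<one>\<^bsub>F\<^esub> = []" using g by (simp add: k_def) (simp add: F_def one_free_group)
  have "sum' (\<delta> t0) L = sum' (\<delta> t0) {\<one>\<^bsub>F\<^esub>}"
    by (rule sum.mono_neutral_right') (use \<delta>0 subgroup.one_closed[OF L] in \<open>auto simp: F_def\<close>)
  also have "\<dots> = 1" by (simp add: \<delta>_def kt0 k1 Dt1)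
  finally have "sum' (\<delta> t0) L = 1" .
  moreover have "derivation F F (\<lambda>w. w) \<delta>"
    by (unfold_locales; simp add: hom_def \<delta>_def k_mult k_inv k derivation.D_mult[OF D])
  moreover have "finite {p \<in> carrier F. \<delta> w p \<noteq> 0}" if "w \<in> carrier F" for w
    by (rule inj_on_finite[OF _ _ fin[OF k[OF that]], of k])
      (use inj_on_conj[OF g] k in \<open>auto simp: k_def \<delta>_def inj_on_def\<close>)
  moreover have "t0 \<in> L" using tL by (simp add: t0_def)
  ultimately show thesis using that by (simp add: F_def)
qed

section \<open>Finitely generated kernels\<close>

text \<open>By normality, \<open>L\<close> fixes every coset of \<open>L\<close> in
  \<open>P\<close>, so the sum of \<open>\<delta>\<close> over such a coset is additive on
  \<open>L\<close>. For the coset of \<open>p\<close> it is nonzero at the conjugate of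
  \<open>t\<close> by \<open>p\<close>, hence at some generator in \<open>S\<close>. The finite
  supports of the chains \<open>\<delta> s\<close> therefore meet every coset.\<close>

lemma finite_index_if_finitely_generated_normal:
  assumes P: "subgroup P (free_group X)"
    and S: "finite S" "S \<subseteq> carrier (free_group X)" and L: "L = generate (free_group X) S"
    and LP: "L \<subseteq> P" and nontriv: "L \<noteq> {\<one>\<^bsub>free_group X\<^esub>}"
    and norm: "\<And>p l. p \<in> P \<Longrightarrow> l \<in> L \<Longrightarrow> p \<otimes>\<^bsub>free_group X\<^esub> l \<otimes>\<^bsub>free_group X\<^esub> inv\<^bsub>free_group X\<^esub> p \<in> L"
  shows "finite ((\<lambda>p. p <#\<^bsub>free_group X\<^esub> L) ` P)"
proof -
  define F where "F = free_group X"
  interpret group F unfolding F_def by (rule group_free_group)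
  have sL: "subgroup L F" using L S generate_is_subgroup by (simp add: F_def)
  have sP: "subgroup P F" using P by (simp add: F_def)
  have LF: "l \<in> carrier F" if "l \<in> L" for l using that sL by (rule subgroup.mem_carrier[rotated])
  have PF: "p \<in> carrier F" if "p \<in> P" for p using that sP by (rule subgroup.mem_carrier[rotated])
  obtain \<delta> t where \<delta>: "derivation F F (\<lambda>w. w) \<delta>"
    and fin: "\<And>w. w \<in> carrier F \<Longrightarrow> finite {p \<in> carrier F. \<delta> w p \<noteq> 0}"
    and t: "t \<in> L" and sum1: "sum' (\<delta> t) L = 1"
    by (rule subgroup_derivation_exists[OF sL[unfolded F_def] nontriv, folded F_def, OF that])
  define \<Phi> where "\<Phi> u p = sum' (\<delta> u) (p <#\<^bsub>F\<^esub> L)" for u p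
  have \<Phi>: "derivation F F (\<lambda>w. w) \<Phi>"
    unfolding \<Phi>_def by (rule derivation.sum_l_cosets[OF \<delta> sL fin])
  note \<Phi>_mult = derivation.D_mult[OF \<Phi>] and \<Phi>_one = derivation.D_one[OF \<Phi>] and \<Phi>_inv = derivation.D_inv[OF \<Phi>]
  have cosl: "(l \<otimes>\<^bsub>F\<^esub> p) <#\<^bsub>F\<^esub> L = p <#\<^bsub>F\<^esub> L" if "p \<in> P" "l \<in> L" for p l
  proof -
    have "inv\<^bsub>F\<^esub> p \<otimes>\<^bsub>F\<^esub> inv\<^bsub>F\<^esub> l \<otimes>\<^bsub>F\<^esub> p \<in> L"
      using norm[folded F_def, of "inv\<^bsub>F\<^esub> p" "inv\<^bsub>F\<^esub> l"] that PF
      by (simp add: subgroup.m_inv_closed[OF sL] subgroup.m_inv_closed[OF sP])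
    then show ?thesis
      using that PF LF l_coset_eq_iff[OF sL, of "l \<otimes>\<^bsub>F\<^esub> p" p] by (simp add: inv_mult_group)
  qed
  have \<Phi>_l: "\<Phi> u (l \<otimes>\<^bsub>F\<^esub> p) = \<Phi> u p" if "p \<in> P" "l \<in> L" for u l p
    using cosl[OF that] by (simp add: \<Phi>_def)
  have vanish: "\<Phi> l p = 0" if p: "p \<in> P" and 0: "\<And>s. s \<in> S \<Longrightarrow> \<Phi> s p = 0" and l: "l \<in> L" for l p
    using l unfolding L F_def[symmetric]
  proof (induction l rule: generate.induct)
    case one
    then show ?case using p PF \<Phi>_one by simp
  next
    case (incl h)
    then show ?case using 0 by simp
  next
    case (inv h)
    have "h \<in> L" using inv L by (auto simp: F_def intro: generate.incl)
    then show ?case using \<Phi>_inv[of h p] \<Phi>_l[OF p] 0[OF inv] p PF LF by simp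
  next
    case (eng h1 h2)
    have h: "h1 \<in> L" "h2 \<in> L" using eng L by (auto simp: F_def)
    have "inv\<^bsub>F\<^esub> h1 \<in> L" using h(1) by (rule subgroup.m_inv_closed[OF sL])
    then show ?case using \<Phi>_mult[of h1 h2 p] \<Phi>_l[OF p] h LF p PF eng by simp
  qed
  have nonzero: "\<exists>s\<in>S. \<Phi> s p \<noteq> 0" if p: "p \<in> P" for p
  proof (rule ccontr)
    assume "\<not> (\<exists>s\<in>S. \<Phi> s p \<noteq> 0)"
    moreover have "p \<otimes>\<^bsub>F\<^esub> t \<otimes>\<^bsub>F\<^esub> inv\<^bsub>F\<^esub> p \<in> L" using norm[OF p t] by (simp add: F_def)
    ultimately have "\<Phi> (p \<otimes>\<^bsub>F\<^esub> t \<otimes>\<^bsub>F\<^esub> inv\<^bsub>F\<^esub> p) p = 0" using vanish[OF p] by blast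
    moreover have c: "p \<in> carrier F" "t \<in> carrier F" "inv\<^bsub>F\<^esub> t \<in> L"
      using p t PF LF subgroup.m_inv_closed[OF sL t] by auto
    \<comment> \<open>The contributions of \<open>p\<close> and of its inverse to the conjugate
      cancel, since \<open>p\<close> times the inverse of \<open>t\<close> lies in the coset of
      \<open>p\<close>. What remains is \<open>\<Phi> t\<close> at the identity, which is
      \<open>1\<close>.\<close>
    moreover have "\<Phi> (inv\<^bsub>F\<^esub> p) (inv\<^bsub>F\<^esub> (p \<otimes>\<^bsub>F\<^esub> t) \<otimes>\<^bsub>F\<^esub> p) = - \<Phi> p p"
    proof -
      have eq: "p \<otimes>\<^bsub>F\<^esub> (inv\<^bsub>F\<^esub> (p \<otimes>\<^bsub>F\<^esub> t) \<otimes>\<^bsub>F\<^esub> p) = p \<otimes>\<^bsub>F\<^esub> inv\<^bsub>F\<^esub> t"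
        using c by (simp add: inv_mult_group m_assoc)
      have "(p \<otimes>\<^bsub>F\<^esub> inv\<^bsub>F\<^esub> t) <#\<^bsub>F\<^esub> L = p <#\<^bsub>F\<^esub> L"
        using c t l_coset_eq_iff[OF sL, of "p \<otimes>\<^bsub>F\<^esub> inv\<^bsub>F\<^esub> t" p] by (simp add: inv_mult_group m_assoc)
      then have "\<Phi> p (p \<otimes>\<^bsub>F\<^esub> inv\<^bsub>F\<^esub> t) = \<Phi> p p" by (simp add: \<Phi>_def)
      then show ?thesis using \<Phi>_inv[of p "inv\<^bsub>F\<^esub> (p \<otimes>\<^bsub>F\<^esub> t) \<otimes>\<^bsub>F\<^esub> p"] c eq by simp
    qed
    moreover have "\<Phi> t \<one>\<^bsub>F\<^esub> = 1"
      using sum1 lcos_mult_one[OF subgroup.subset[OF sL]] by (simp add: \<Phi>_def)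
    ultimately show False
      using \<Phi>_mult[of "p \<otimes>\<^bsub>F\<^esub> t" "inv\<^bsub>F\<^esub> p" p] \<Phi>_mult[of p t p] by simp
  qed
  have "(\<lambda>p. p <#\<^bsub>F\<^esub> L) ` P \<subseteq> (\<lambda>q. q <#\<^bsub>F\<^esub> L) ` (\<Union>s\<in>S. {q \<in> carrier F. \<delta> s q \<noteq> 0})"
  proof (rule image_subsetI)
    fix p assume p: "p \<in> P"
    obtain s where s: "s \<in> S" "\<Phi> s p \<noteq> 0" using nonzero[OF p] by blast
    then obtain q where q: "q \<in> p <#\<^bsub>F\<^esub> L" "\<delta> s q \<noteq> 0"
      unfolding \<Phi>_def by (auto elim: sum'_nonzeroE)
    have "q \<in> carrier F" "p <#\<^bsub>F\<^esub> L = q <#\<^bsub>F\<^esub> L"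
      using l_coset_carrier[OF q(1) PF[OF p] sL] l_repr_independence[OF q(1) PF[OF p] sL] by auto
    then show "p <#\<^bsub>F\<^esub> L \<in> (\<lambda>q. q <#\<^bsub>F\<^esub> L) ` (\<Union>s\<in>S. {q \<in> carrier F. \<delta> s q \<noteq> 0})"
      using s(1) q(2) by blast
  qed
  moreover have "finite (\<Union>s\<in>S. {q \<in> carrier F. \<delta> s q \<noteq> 0})"
    using S fin by (intro finite_UN_I) (auto simp: F_def)
  ultimately show ?thesis
    unfolding F_def[symmetric] by (rule finite_subset[OF _ finite_imageI])
qed

text \<open>The finite support of \<open>f\<close> in \<open>K\<close> splits along the left cosets
  of \<open>K0\<close>. The contrapositive serves later: a nonzero sum over \<open>K\<close>
  survives on some coset of \<open>K0\<close>.\<close>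

lemma sum'_eq_0_if_l_cosets:
  assumes "group G" and K: "subgroup K G" and K0: "subgroup K0 G" "K0 \<subseteq> K"
    and fin: "finite {q \<in> carrier G. f q \<noteq> 0}"
    and 0: "\<And>k. k \<in> K \<Longrightarrow> sum' f (k <#\<^bsub>G\<^esub> K0) = 0"
  shows "sum' f K = (0::int)"
proof -
  interpret group G by fact
  define A where "A = {q \<in> K. f q \<noteq> 0}"
  have KG: "K \<subseteq> carrier G" using K by (rule subgroup.subset)
  have A: "finite A" by (rule finite_subset[OF _ fin]) (use KG in \<open>auto simp: A_def\<close>)
  have part: "{q \<in> A. q <#\<^bsub>G\<^esub> K0 = k <#\<^bsub>G\<^esub> K0} = {q \<in> k <#\<^bsub>G\<^esub> K0. f q \<noteq> 0}" if k: "k \<in> K" for k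
  proof -
    have kG: "k \<in> carrier G" using k KG by auto
    have "q \<in> K" if "q \<in> k <#\<^bsub>G\<^esub> K0" for q
      using that k K0(2) subgroup.m_closed[OF K k] by (auto simp: l_coset_def)
    moreover have "q <#\<^bsub>G\<^esub> K0 = k <#\<^bsub>G\<^esub> K0 \<longleftrightarrow> q \<in> k <#\<^bsub>G\<^esub> K0" if "q \<in> K" for q
      using that KG kG l_repr_independence[OF _ kG K0(1), of q] l_coset_self[OF K0(1), of q] by auto
    ultimately show ?thesis by (auto simp: A_def)
  qed
  have "sum' f K = sum f A" using A by (simp add: sum.G_def A_def)
  also have "\<dots> = sum (\<lambda>C. sum f {q \<in> A. q <#\<^bsub>G\<^esub> K0 = C}) ((\<lambda>q. q <#\<^bsub>G\<^esub> K0) ` A)"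
    by (rule sum.image_gen[OF A])
  also have "\<dots> = 0"
  proof (rule sum.neutral, safe)
    fix k assume k: "k \<in> A"
    then have kK: "k \<in> K" by (simp add: A_def)
    have "finite {q \<in> k <#\<^bsub>G\<^esub> K0. f q \<noteq> 0}"
      unfolding part[OF kK, symmetric] using A by simp
    then have "sum f {q \<in> k <#\<^bsub>G\<^esub> K0. f q \<noteq> 0} = sum' f (k <#\<^bsub>G\<^esub> K0)" by (simp add: sum.G_def)
    then show "sum f {q \<in> A. q <#\<^bsub>G\<^esub> K0 = k <#\<^bsub>G\<^esub> K0} = 0"
      using 0[OF kK] part[OF kK] by simp
  qed
  finally show ?thesis .
qed

section \<open>Preimages, and lifting a derivation along a homomorphism\<close>

lemma (in group_hom) subgroup_vimage:
  assumes "subgroup L H"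
  shows "subgroup {x \<in> carrier G. h x \<in> L} G"
  by (rule G.subgroupI)
    (auto intro: exI[of _ "\<one>"] simp: subgroup.one_closed[OF assms] subgroup.m_closed[OF assms] subgroup.m_inv_closed[OF assms])

text \<open>The chain of each generator is lifted to \<open>H\<close> by moving its coefficients to
  a transversal of \<open>\<theta>\<close>. The coset sums of the resulting derivation agree with
  those of \<open>\<delta>\<close> on generators, hence on all words.\<close>

lemma lift_derivation:
  assumes "derivation A A (\<lambda>a. a) \<delta>" and fin: "\<And>a. a \<in> carrier A \<Longrightarrow> finite {p \<in> carrier A. \<delta> a p \<noteq> 0}"
    and "group_hom (free_group I) H \<pi>" and "group_hom H A \<theta>"
    and L: "subgroup L A" "L \<subseteq> \<theta> ` carrier H"
  obtains D where "derivation (free_group I) H \<pi> D"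
    and "\<And>w. w \<in> carrier (free_group I) \<Longrightarrow> finite {h \<in> carrier H. D w h \<noteq> 0}"
    and "\<And>w h. w \<in> carrier (free_group I) \<Longrightarrow> h \<in> carrier H \<Longrightarrow>
      sum' (D w) (h <#\<^bsub>H\<^esub> {h \<in> carrier H. \<theta> h \<in> L}) = sum' (\<delta> (\<theta> (\<pi> w))) (\<theta> h <#\<^bsub>A\<^esub> L)"
proof -
  interpret \<pi>: group_hom "free_group I" H \<pi> by fact
  interpret \<theta>: group_hom H A \<theta> by fact
  have \<delta>L: "derivation A A (\<lambda>a. a) (\<lambda>a p. sum' (\<delta> a) (p <#\<^bsub>A\<^esub> L))"
    by (rule derivation.sum_l_cosets[OF assms(1) L(1) fin])
  \<comment> \<open>\<open>T\<close> contains one preimage of each point in the image of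
    \<open>\<theta>\<close>. Coefficients outside the image are dropped, which does no harm: as
    \<open>L\<close> lies in the image, so does every coset to be summed over.\<close>
  define T where "T = inv_into (carrier H) \<theta> ` \<theta> ` carrier H"
  have TH: "T \<subseteq> carrier H" by (auto simp: T_def inv_into_into)
  have inj: "inj_on \<theta> T" by (auto simp: T_def inj_on_def f_inv_into_f)
  have onto: "\<exists>q\<in>T. \<theta> q = \<theta> h" if "h \<in> carrier H" for h
    using that by (auto simp: T_def f_inv_into_f)
  have gen: "\<pi> [(i, True)] \<in> carrier H" if "i \<in> I" for i
    using that by (simp add: letter_closed)
  define c where "c i h = (if h \<in> T then \<delta> (\<theta> (\<pi> [(i, True)])) (\<theta> h) else 0)" for i h
  have c: "finite {h \<in> carrier H. c i h \<noteq> 0}" if i: "i \<in> I" for i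
    by (rule inj_on_finite[OF _ _ fin[OF \<theta>.hom_closed[OF gen[OF i]]], of \<theta>])
      (use inj in \<open>auto simp: c_def inj_on_def\<close>)
  obtain D where D: "derivation (free_group I) H \<pi> D"
    and D_gen: "\<And>i h. i \<in> I \<Longrightarrow> h \<in> carrier H \<Longrightarrow> D [(i, True)] h = c i h"
    and D_fin: "\<And>w. w \<in> carrier (free_group I) \<Longrightarrow> finite {h \<in> carrier H. D w h \<noteq> 0}"
    by (rule free_derivation_exists[where c = c, OF \<pi>.H.group_axioms \<pi>.homh c that])
  define K where "K = {h \<in> carrier H. \<theta> h \<in> L}"
  have K: "subgroup K H"
    unfolding K_def by (rule \<theta>.subgroup_vimage[OF L(1)])
  have DK: "derivation (free_group I) H \<pi> (\<lambda>w h. sum' (D w) (h <#\<^bsub>H\<^esub> K))"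
    by (rule derivation.sum_l_cosets[OF D K D_fin])
  let ?E = "\<lambda>w h. sum' (D w) (h <#\<^bsub>H\<^esub> K) - sum' (\<delta> (\<theta> (\<pi> w))) (\<theta> h <#\<^bsub>A\<^esub> L)"
  have E: "derivation (free_group I) H \<pi> ?E"
    by unfold_locales (simp add: derivation.D_mult[OF DK] derivation.D_mult[OF \<delta>L])
  have "?E w h = 0" if w: "w \<in> carrier (free_group I)" and h: "h \<in> carrier H" for w h
  proof (rule free_derivation_eq_0[OF E _ w h])
    fix i h assume i: "i \<in> I" and h: "h \<in> carrier H"
    have hK: "q \<in> h <#\<^bsub>H\<^esub> K \<longleftrightarrow> q \<in> carrier H \<and> \<theta> q \<in> \<theta> h <#\<^bsub>A\<^esub> L" for q
      unfolding \<pi>.H.mem_l_coset_iff[OF K h] \<theta>.H.mem_l_coset_iff[OF L(1) \<theta>.hom_closed[OF h]]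
      using h by (auto simp: K_def)
    have "sum' (D [(i, True)]) (h <#\<^bsub>H\<^esub> K) = sum' (c i) (h <#\<^bsub>H\<^esub> K)"
      by (rule sum.cong') (auto simp: hK D_gen i)
    also have "\<dots> = sum' (c i) ((h <#\<^bsub>H\<^esub> K) \<inter> T)"
      by (rule sum.mono_neutral_right') (auto simp: c_def)
    also have "\<dots> = sum' (\<delta> (\<theta> (\<pi> [(i, True)]))) (\<theta> h <#\<^bsub>A\<^esub> L)"
    proof (rule sum'_bij_betw)
      have "\<theta> h <#\<^bsub>A\<^esub> L \<subseteq> \<theta> ` ((h <#\<^bsub>H\<^esub> K) \<inter> T)"
      proof
        fix p assume p: "p \<in> \<theta> h <#\<^bsub>A\<^esub> L"
        then obtain k where k: "k \<in> carrier H" "p = \<theta> h \<otimes>\<^bsub>A\<^esub> \<theta> k"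
          using L(2) by (auto simp: l_coset_def)
        then have "p = \<theta> (h \<otimes>\<^bsub>H\<^esub> k)" using h by simp
        then obtain q where "q \<in> T" "\<theta> q = p"
          using onto[of "h \<otimes>\<^bsub>H\<^esub> k"] h k(1) by auto
        then show "p \<in> \<theta> ` ((h <#\<^bsub>H\<^esub> K) \<inter> T)"
          using p TH hK by blast
      qed
      then show "bij_betw \<theta> ((h <#\<^bsub>H\<^esub> K) \<inter> T) (\<theta> h <#\<^bsub>A\<^esub> L)"
        using inj hK by (auto simp: bij_betw_def inj_on_def)
    qed (simp add: c_def)
    finally show "?E [(i, True)] h = 0" by simp
  qed
  then show thesis using that[OF D D_fin] by (simp add: K_def)
qed

text \<open>The preimage \<open>K\<close> of \<open>L\<close> is the product of the kernels
  \<open>N1\<close> and \<open>N2\<close>, and \<open>\<eta>\<close> kills \<open>N2\<close>. Once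
  \<open>N1\<close> meets only finitely many cosets of a subgroup generated by \<open>N2\<close> and
  a finite set \<open>Q\<close>, the images of \<open>Q\<close> and of coset representatives
  generate the image of \<open>N1\<close>.\<close>

lemma image_kernel_finitely_generated:
  assumes "finite R" and R: "R \<subseteq> carrier (free_group I)"
    and "group_hom (free_group I) H \<pi>" and surj: "\<pi> ` carrier (free_group I) = carrier H"
    and ker: "kernel (free_group I) H \<pi> = normal_closure (free_group I) R"
    and "group_hom H (free_group X) \<theta>" and "group_hom H B \<eta>"
    and comm: "\<And>h k. \<lbrakk>h \<in> kernel H (free_group X) \<theta>; k \<in> kernel H B \<eta>\<rbrakk> \<Longrightarrow> h \<otimes>\<^bsub>H\<^esub> k = k \<otimes>\<^bsub>H\<^esub> h"
    and nontriv: "\<theta> ` kernel H B \<eta> \<noteq> {\<one>\<^bsub>free_group X\<^esub>}"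
  obtains S where "finite S" "S \<subseteq> carrier B" "generate B S = \<eta> ` kernel H (free_group X) \<theta>"
proof -
  define A where "A = free_group X"
  interpret \<pi>: group_hom "free_group I" H \<pi> by fact
  interpret \<theta>: group_hom H A \<theta> using assms by (simp add: A_def)
  interpret \<eta>: group_hom H B \<eta> by fact
  define N1 where "N1 = kernel H A \<theta>"
  define N2 where "N2 = kernel H B \<eta>"
  have N1: "subgroup N1 H" and N2: "subgroup N2 H"
    by (simp_all add: N1_def N2_def \<theta>.subgroup_kernel \<eta>.subgroup_kernel)
  have N1H: "n \<in> carrier H" "\<theta> n = \<one>\<^bsub>A\<^esub>" if "n \<in> N1" for n using that by (auto simp: N1_def kernel_def)
  have N2H: "n \<in> carrier H" "\<eta> n = \<one>\<^bsub>B\<^esub>" if "n \<in> N2" for n using that by (auto simp: N2_def kernel_def)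
  define L where "L = \<theta> ` N2"
  have L: "subgroup L A" unfolding L_def by (rule \<theta>.subgroup_img_is_subgroup[OF N2])
  have L_img: "L \<subseteq> \<theta> ` carrier H" using N2H by (auto simp: L_def)
  obtain \<delta> t where \<delta>: "derivation A A (\<lambda>w. w) \<delta>"
    and \<delta>_fin: "\<And>w. w \<in> carrier A \<Longrightarrow> finite {p \<in> carrier A. \<delta> w p \<noteq> 0}"
    and "t \<in> L" and sum1: "sum' (\<delta> t) L = 1"
    by (rule subgroup_derivation_exists[OF L[unfolded A_def] nontriv[folded N2_def L_def], folded A_def, OF that])
  then obtain \<tau> where \<tau>: "\<tau> \<in> N2" "\<theta> \<tau> = t" by (auto simp: L_def)
  define K where "K = {h \<in> carrier H. \<theta> h \<in> L}"
  have K: "subgroup K H" unfolding K_def by (rule \<theta>.subgroup_vimage[OF L])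
  have K_split: "\<exists>n\<in>N1. \<exists>m\<in>N2. k = n \<otimes>\<^bsub>H\<^esub> m" if k: "k \<in> K" for k
  proof -
    obtain m where m: "m \<in> N2" "\<theta> k = \<theta> m" using k by (auto simp: K_def L_def)
    have "k \<otimes>\<^bsub>H\<^esub> inv\<^bsub>H\<^esub> m \<in> N1" "k = (k \<otimes>\<^bsub>H\<^esub> inv\<^bsub>H\<^esub> m) \<otimes>\<^bsub>H\<^esub> m"
      using k m N2H by (auto simp: N1_def kernel_def K_def \<pi>.H.m_assoc)
    then show ?thesis using m by blast
  qed
  obtain D where D: "derivation (free_group I) H \<pi> D"
    and D_fin: "\<And>w. w \<in> carrier (free_group I) \<Longrightarrow> finite {h \<in> carrier H. D w h \<noteq> 0}"
    and D_sum: "\<And>w h. w \<in> carrier (free_group I) \<Longrightarrow> h \<in> carrier H \<Longrightarrow>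
      sum' (D w) (h <#\<^bsub>H\<^esub> K) = sum' (\<delta> (\<theta> (\<pi> w))) (\<theta> h <#\<^bsub>A\<^esub> L)"
    by (rule lift_derivation[OF \<delta> \<delta>_fin \<pi>.group_hom_axioms \<theta>.group_hom_axioms L L_img, folded K_def], assumption, rule that)
  define supp where "supp w = {h \<in> carrier H. D w h \<noteq> 0}" for w
  \<comment> \<open>\<open>Q\<close> collects the quotients in \<open>K\<close> of two support
    points of one relator. Adjoining it to \<open>N2\<close> puts support points of a relator that
    share a coset of \<open>K\<close> into a common coset of \<open>K0\<close>.\<close>
  define Q where "Q = (\<lambda>(q, q'). inv\<^bsub>H\<^esub> q \<otimes>\<^bsub>H\<^esub> q') ` (\<Union>r\<in>R. supp r \<times> supp r) \<inter> K"
  have "finite Q" using D_fin R \<open>finite R\<close> by (auto simp: Q_def supp_def subset_iff)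
  have QK: "Q \<subseteq> K" by (simp add: Q_def)
  have N2K: "N2 \<subseteq> K" using N2H by (auto simp: K_def L_def)
  have KH: "K \<subseteq> carrier H" by (auto simp: K_def)
  define K0 where "K0 = generate H (N2 \<union> Q)"
  have gensH: "N2 \<union> Q \<subseteq> carrier H" using N2K QK KH by blast
  have K0: "subgroup K0 H" unfolding K0_def by (rule \<pi>.H.generate_is_subgroup[OF gensH])
  have K0K: "K0 \<subseteq> K" unfolding K0_def using N2K QK by (intro \<pi>.H.generate_subgroup_incl K) auto
  have N2K0: "N2 \<subseteq> K0" and QK0: "Q \<subseteq> K0" by (auto simp: K0_def intro: generate.incl)
  define \<Phi> where "\<Phi> w h = sum' (D w) (h <#\<^bsub>H\<^esub> K0)" for w h
  have \<Phi>: "derivation (free_group I) H \<pi> \<Phi>"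
    unfolding \<Phi>_def by (rule derivation.sum_l_cosets[OF D K0 D_fin])
  note \<Phi>_mult = derivation.D_mult[OF \<Phi>]
  have \<Phi>_coset: "\<Phi> w g = \<Phi> w h" if "g \<in> carrier H" "h \<in> carrier H" "inv\<^bsub>H\<^esub> g \<otimes>\<^bsub>H\<^esub> h \<in> K0" for w g h
    using iffD2[OF \<pi>.H.l_coset_eq_iff[OF K0 that(1,2)] that(3)] by (simp add: \<Phi>_def)
  have R1: "\<pi> r = \<one>\<^bsub>H\<^esub>" if "r \<in> R" for r
  proof -
    have "R \<subseteq> normal_closure (free_group I) R" by (auto simp: normal_closure_def)
    then show ?thesis using that ker by (auto simp: kernel_def)
  qed
  \<comment> \<open>By the choice of \<open>Q\<close>, the support of \<open>D r\<close> in a coset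
    of \<open>K\<close> lies in one coset of \<open>K0\<close>. A nonzero sum over the latter would
    equal the sum over the former, which is a coset sum of \<open>\<delta>\<close> at the identity,
    hence zero.\<close>
  have \<Phi>_R: "\<Phi> r h = 0" if r: "r \<in> R" and h: "h \<in> carrier H" for r h
  proof (rule ccontr)
    assume "\<Phi> r h \<noteq> 0"
    then obtain q where q: "q \<in> h <#\<^bsub>H\<^esub> K0" "D r q \<noteq> 0"
      unfolding \<Phi>_def by (rule sum'_nonzeroE)
    have qH: "q \<in> carrier H" and eq: "h <#\<^bsub>H\<^esub> K0 = q <#\<^bsub>H\<^esub> K0"
      using \<pi>.H.l_coset_carrier[OF q(1) h K0] \<pi>.H.l_repr_independence[OF q(1) h K0] by auto
    have rF: "r \<in> carrier (free_group I)" using r R by blast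
    have "sum' (D r) (q <#\<^bsub>H\<^esub> K0) = sum' (D r) (q <#\<^bsub>H\<^esub> K)"
    proof (rule sum.mono_neutral_left')
      show "q <#\<^bsub>H\<^esub> K0 \<subseteq> q <#\<^bsub>H\<^esub> K" using K0K by (auto simp: l_coset_def)
      show "\<forall>i \<in> (q <#\<^bsub>H\<^esub> K) - (q <#\<^bsub>H\<^esub> K0). D r i = 0"
      proof (rule ballI, rule ccontr)
        fix i assume i: "i \<in> (q <#\<^bsub>H\<^esub> K) - (q <#\<^bsub>H\<^esub> K0)" and "D r i \<noteq> 0"
        have iH: "i \<in> carrier H" "inv\<^bsub>H\<^esub> q \<otimes>\<^bsub>H\<^esub> i \<in> K" using i \<pi>.H.mem_l_coset_iff[OF K qH] by auto
        have "inv\<^bsub>H\<^esub> q \<otimes>\<^bsub>H\<^esub> i \<in> Q"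
          using iH qH \<open>D r i \<noteq> 0\<close> q(2) r by (force simp: Q_def supp_def)
        then have "i \<in> q <#\<^bsub>H\<^esub> K0"
          using QK0 iH(1) by (auto simp: \<pi>.H.mem_l_coset_iff[OF K0 qH])
        then show False using i by blast
      qed
    qed
    also have "\<dots> = sum' (\<delta> \<one>\<^bsub>A\<^esub>) (\<theta> q <#\<^bsub>A\<^esub> L)"
      using D_sum[OF rF qH] R1[OF r] by simp
    also have "\<dots> = 0"
    proof (rule ccontr)
      assume "sum' (\<delta> \<one>\<^bsub>A\<^esub>) (\<theta> q <#\<^bsub>A\<^esub> L) \<noteq> 0"
      then obtain p where p: "p \<in> \<theta> q <#\<^bsub>A\<^esub> L" "\<delta> \<one>\<^bsub>A\<^esub> p \<noteq> 0" by (rule sum'_nonzeroE)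
      then show False
        using derivation.D_one[OF \<delta>] \<theta>.H.l_coset_carrier[OF p(1) _ L] qH by simp
    qed
    finally show False using \<open>\<Phi> r h \<noteq> 0\<close> eq by (simp add: \<Phi>_def)
  qed
  have \<Phi>_ker: "\<Phi> w h = 0" if "w \<in> carrier (free_group I)" "\<pi> w = \<one>\<^bsub>H\<^esub>" "h \<in> carrier H" for w h
  proof (rule derivation.D_normal_closure[OF \<Phi> R R1 \<Phi>_R])
    show "w \<in> normal_closure (free_group I) R" using that ker by (auto simp: kernel_def)
  qed (use that in auto)
  \<comment> \<open>This is the descent to \<open>H\<close>: two words with the same image differ by
    an element of the kernel, on which \<open>\<Phi>\<close> vanishes.\<close>
  have \<Phi>_cong: "\<Phi> u h = \<Phi> v h"
    if "u \<in> carrier (free_group I)" "v \<in> carrier (free_group I)" "\<pi> u = \<pi> v" "h \<in> carrier H" for u v h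
  proof -
    let ?z = "inv\<^bsub>free_group I\<^esub> v \<otimes>\<^bsub>free_group I\<^esub> u"
    have "\<Phi> (v \<otimes>\<^bsub>free_group I\<^esub> ?z) h = \<Phi> v h + \<Phi> ?z (inv\<^bsub>H\<^esub> \<pi> v \<otimes>\<^bsub>H\<^esub> h)"
      using that by (intro \<Phi>_mult) auto
    moreover have "v \<otimes>\<^bsub>free_group I\<^esub> ?z = u" using that by (simp add: \<pi>.G.m_assoc[symmetric])
    moreover have "\<Phi> ?z (inv\<^bsub>H\<^esub> \<pi> v \<otimes>\<^bsub>H\<^esub> h) = 0" using that by (intro \<Phi>_ker) auto
    ultimately show ?thesis by simp
  qed
  obtain w where w: "w \<in> carrier (free_group I)" "\<pi> w = \<tau>"
    using surj N2H(1)[OF \<tau>(1)] by (metis imageE)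
  \<comment> \<open>Since \<open>\<tau>\<close> commutes with \<open>N1\<close>, \<open>\<Phi> w\<close> is constant on \<open>N1\<close>; as it is not zero, its support meets
    every coset of \<open>K0\<close> in \<open>K\<close>.\<close>
  have \<Phi>_const: "\<Phi> w n = \<Phi> w \<one>\<^bsub>H\<^esub>" if n: "n \<in> N1" for n
  proof -
    have nH: "n \<in> carrier H" and \<tau>H: "\<tau> \<in> carrier H" using N1H[OF n] N2H[OF \<tau>(1)] by auto
    obtain v where v: "v \<in> carrier (free_group I)" "\<pi> v = n" using surj nH by (metis imageE)
    have n\<tau>: "n \<otimes>\<^bsub>H\<^esub> \<tau> = \<tau> \<otimes>\<^bsub>H\<^esub> n" using comm n \<tau>(1) by (simp add: N1_def N2_def A_def)
    \<comment> \<open>Expanding both sides gives values of \<open>\<Phi> v\<close> at two points of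
      one coset of \<open>K0\<close>, which cancel; what is left is \<open>\<Phi> w\<close> at
      \<open>n\<close> and at the identity.\<close>
    have "\<Phi> (w \<otimes>\<^bsub>free_group I\<^esub> v) n = \<Phi> (v \<otimes>\<^bsub>free_group I\<^esub> w) n"
      using w v nH n\<tau> by (intro \<Phi>_cong) auto
    moreover have "\<Phi> v (inv\<^bsub>H\<^esub> \<tau> \<otimes>\<^bsub>H\<^esub> n) = \<Phi> v n"
    proof (rule \<Phi>_coset)
      have "inv\<^bsub>H\<^esub> (inv\<^bsub>H\<^esub> \<tau> \<otimes>\<^bsub>H\<^esub> n) \<otimes>\<^bsub>H\<^esub> n = inv\<^bsub>H\<^esub> n \<otimes>\<^bsub>H\<^esub> (n \<otimes>\<^bsub>H\<^esub> \<tau>)"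
        using nH \<tau>H by (simp add: \<pi>.H.inv_mult_group \<pi>.H.m_assoc n\<tau>)
      also have "\<dots> = \<tau>" using nH \<tau>H by (simp add: \<pi>.H.m_assoc[symmetric])
      finally show "inv\<^bsub>H\<^esub> (inv\<^bsub>H\<^esub> \<tau> \<otimes>\<^bsub>H\<^esub> n) \<otimes>\<^bsub>H\<^esub> n \<in> K0" using \<tau>(1) N2K0 by auto
    qed (use nH \<tau>H in auto)
    ultimately show ?thesis
      using \<Phi>_mult[OF w(1) v(1) nH] \<Phi>_mult[OF v(1) w(1) nH] w v nH by simp
  qed
  have "sum' (D w) K = 1"
    using D_sum[OF w(1) \<pi>.H.one_closed] w(2) \<tau>(2) sum1 \<pi>.H.lcos_mult_one[OF KH]
      \<theta>.H.lcos_mult_one[OF subgroup.subset[OF L]] by simp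
  then obtain k where k: "k \<in> K" "\<Phi> w k \<noteq> 0"
    using sum'_eq_0_if_l_cosets[OF \<pi>.H.group_axioms K K0 K0K D_fin[OF w(1)]] unfolding \<Phi>_def by fastforce
  have \<Phi>_N1: "\<Phi> w n \<noteq> 0" if n: "n \<in> N1" for n
  proof -
    obtain n' m where nm: "n' \<in> N1" "m \<in> N2" "k = n' \<otimes>\<^bsub>H\<^esub> m" using K_split[OF k(1)] by blast
    have "inv\<^bsub>H\<^esub> n' \<otimes>\<^bsub>H\<^esub> k = m"
      using nm N1H(1)[OF nm(1)] N2H(1)[OF nm(2)] by (simp add: \<pi>.H.m_assoc[symmetric])
    then have "\<Phi> w n' = \<Phi> w k"
      using nm k(1) KH N1H(1)[OF nm(1)] N2K0 by (intro \<Phi>_coset) auto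
    then show ?thesis using k(2) \<Phi>_const[OF n] \<Phi>_const[OF nm(1)] by simp
  qed
  have "(\<lambda>n. n <#\<^bsub>H\<^esub> K0) ` N1 \<subseteq> (\<lambda>q. q <#\<^bsub>H\<^esub> K0) ` supp w"
  proof (rule image_subsetI)
    fix n assume n: "n \<in> N1"
    have nH: "n \<in> carrier H" using N1H[OF n] by simp
    obtain q where q: "q \<in> n <#\<^bsub>H\<^esub> K0" "D w q \<noteq> 0"
      using \<Phi>_N1[OF n] unfolding \<Phi>_def by (rule sum'_nonzeroE)
    have "q \<in> carrier H" "n <#\<^bsub>H\<^esub> K0 = q <#\<^bsub>H\<^esub> K0"
      using \<pi>.H.l_coset_carrier[OF q(1) nH K0] \<pi>.H.l_repr_independence[OF q(1) nH K0] by auto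
    then show "n <#\<^bsub>H\<^esub> K0 \<in> (\<lambda>q. q <#\<^bsub>H\<^esub> K0) ` supp w" using q(2) by (auto simp: supp_def)
  qed
  then have "finite ((\<lambda>n. n <#\<^bsub>H\<^esub> K0) ` N1)"
    by (rule finite_subset) (simp add: supp_def D_fin[OF w(1)])
  then obtain C where C: "C \<subseteq> N1" "finite C" "(\<lambda>n. n <#\<^bsub>H\<^esub> K0) ` N1 = (\<lambda>n. n <#\<^bsub>H\<^esub> K0) ` C"
    using finite_subset_image[of "(\<lambda>n. n <#\<^bsub>H\<^esub> K0) ` N1" "\<lambda>n. n <#\<^bsub>H\<^esub> K0" N1] by blast
  \<comment> \<open>\<open>C\<close> represents the cosets of \<open>K0\<close> met by
    \<open>N1\<close>. As \<open>\<eta>\<close> kills \<open>N2\<close>, the image of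
    \<open>K0\<close> comes from \<open>Q\<close>, and every element of \<open>N1\<close> is a
    representative times an element of \<open>K0\<close>.\<close>
  define S where "S = \<eta> ` C \<union> \<eta> ` Q"
  have SB: "S \<subseteq> carrier B" using C(1) N1H(1) QK KH by (force simp: S_def)
  have sS: "subgroup (generate B S) B" by (rule \<eta>.H.generate_is_subgroup[OF SB])
  show thesis
  proof
    show "finite S" using C \<open>finite Q\<close> by (simp add: S_def)
    show "S \<subseteq> carrier B" by (rule SB)
    show "generate B S = \<eta> ` kernel H (free_group X) \<theta>"
      unfolding A_def[symmetric] N1_def[symmetric]
    proof
      have "\<eta> ` Q \<subseteq> \<eta> ` N1"
      proof (rule image_subsetI)
        fix q assume "q \<in> Q"
        then obtain n m where "n \<in> N1" "m \<in> N2" "q = n \<otimes>\<^bsub>H\<^esub> m" using K_split QK by blast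
        then show "\<eta> q \<in> \<eta> ` N1" using N1H N2H by auto
      qed
      then show "generate B S \<subseteq> \<eta> ` N1"
        using C(1) by (intro \<eta>.H.generate_subgroup_incl \<eta>.subgroup_img_is_subgroup[OF N1]) (auto simp: S_def)
      have "\<eta> ` (N2 \<union> Q) \<subseteq> generate B S"
        using N2H(2) subgroup.one_closed[OF sS] by (auto simp: S_def intro: generate.incl)
      then have \<eta>K0: "\<eta> ` K0 \<subseteq> generate B S"
        unfolding K0_def \<eta>.generate_img[OF gensH, symmetric] by (rule \<eta>.H.generate_subgroup_incl[OF _ sS])
      show "\<eta> ` N1 \<subseteq> generate B S"
      proof (rule image_subsetI)
        fix n assume n: "n \<in> N1"
        obtain a where a: "a \<in> C" "a <#\<^bsub>H\<^esub> K0 = n <#\<^bsub>H\<^esub> K0" using n C(3) by (metis (no_types, lifting) image_iff)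
        have aH: "a \<in> carrier H" "n \<in> carrier H" using a(1) C(1) n N1H by auto
        have "inv\<^bsub>H\<^esub> a \<otimes>\<^bsub>H\<^esub> n \<in> K0" using a(2) aH \<pi>.H.l_coset_eq_iff[OF K0] by blast
        then have "\<eta> (inv\<^bsub>H\<^esub> a \<otimes>\<^bsub>H\<^esub> n) \<in> generate B S" using \<eta>K0 by blast
        moreover have "\<eta> a \<in> generate B S" using a(1) by (auto simp: S_def intro: generate.incl)
        ultimately have "\<eta> a \<otimes>\<^bsub>B\<^esub> \<eta> (inv\<^bsub>H\<^esub> a \<otimes>\<^bsub>H\<^esub> n) \<in> generate B S"
          by (rule generate.eng[rotated])
        then show "\<eta> n \<in> generate B S" using aH by (simp add: \<eta>.H.m_assoc[symmetric])
      qed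
    qed
  qed
qed

section \<open>Finite index normal subgroups and free generators\<close>

lemma finite_image_factor:
  assumes "finite (f ` A)" and "\<And>x y. x \<in> A \<Longrightarrow> y \<in> A \<Longrightarrow> f x = f y \<Longrightarrow> g x = g y"
  shows "finite (g ` A)"
proof -
  have "g x = g (inv_into A f (f x))" if "x \<in> A" for x
    using assms(2)[OF that inv_into_into[OF imageI[OF that, of f]]] f_inv_into_f[OF imageI[OF that, of f]] by simp
  then have "g ` A \<subseteq> (\<lambda>y. g (inv_into A f y)) ` f ` A" by blast
  then show ?thesis using assms(1) by (rule finite_subset[OF _ finite_imageI])
qed

lemma (in group) finite_index_normal_carrier: "finite_index_normal G (carrier G)"
  using coset_join2[OF _ subgroup_self] normal_self
  by (auto simp: finite_index_normal_def RCOSETS_def)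

text \<open>Each coset of the preimage is the preimage of a coset of \<open>N\<close>, so finiteness
  carries over.\<close>

lemma (in group_hom) finite_index_normal_vimage:
  assumes N: "finite_index_normal H N"
  shows "finite_index_normal G {x \<in> carrier G. h x \<in> N}"
proof -
  have nN: "N \<lhd> H" and fin: "finite (rcosets\<^bsub>H\<^esub> N)" using N by (auto simp: finite_index_normal_def)
  have sN: "subgroup N H" using nN by (rule normal_imp_subgroup)
  let ?M = "{x \<in> carrier G. h x \<in> N}"
  have sM: "subgroup ?M G" by (rule subgroup_vimage[OF sN])
  have "?M \<lhd> G"
    using sM by (rule G.normal_invI) (auto intro: normal.inv_op_closed2[OF nN])
  moreover have "rcosets\<^bsub>G\<^esub> ?M \<subseteq> (\<lambda>D. {x \<in> carrier G. h x \<in> D}) ` (rcosets\<^bsub>H\<^esub> N)"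
  proof
    fix C assume "C \<in> rcosets\<^bsub>G\<^esub> ?M"
    then obtain g where g: "g \<in> carrier G" "C = ?M #>\<^bsub>G\<^esub> g" by (auto simp: RCOSETS_def)
    have "x \<in> C \<longleftrightarrow> x \<in> carrier G \<and> h x \<in> N #>\<^bsub>H\<^esub> h g" for x
    proof (cases "x \<in> carrier G")
      case True
      then show ?thesis
        using g subgroup.rcos_module[OF sM G.group_axioms g(1) True]
          subgroup.rcos_module[OF sN H.group_axioms hom_closed[OF g(1)] hom_closed[OF True]] by simp
    next
      case False
      then show ?thesis using g G.r_coset_subset_G[OF subgroup.subset[OF sM] g(1)] by blast
    qed
    moreover have "N #>\<^bsub>H\<^esub> h g \<in> rcosets\<^bsub>H\<^esub> N" using g(1) by (auto simp: RCOSETS_def)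
    ultimately show "C \<in> (\<lambda>D. {x \<in> carrier G. h x \<in> D}) ` (rcosets\<^bsub>H\<^esub> N)" by blast
  qed
  then have "finite (rcosets\<^bsub>G\<^esub> ?M)" using fin by (rule finite_subset[OF _ finite_imageI])
  ultimately show ?thesis by (simp add: finite_index_normal_def)
qed

lemma (in group) finite_index_normal_separates_finite:
  assumes "finite C" and "\<And>c. c \<in> C \<Longrightarrow> \<exists>M. finite_index_normal G M \<and> c \<notin> L <#> M"
  shows "\<exists>M. finite_index_normal G M \<and> (\<forall>c\<in>C. c \<notin> L <#> M)"
  using assms
proof (induction C rule: finite_induct)
  case empty
  then show ?case using finite_index_normal_carrier by blast
next
  case (insert c C)
  obtain M where M: "finite_index_normal G M" "\<forall>c\<in>C. c \<notin> L <#> M" using insert by auto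
  obtain M' where M': "finite_index_normal G M'" "c \<notin> L <#> M'" using insert.prems by auto
  have "L <#> (M \<inter> M') \<subseteq> L <#> M" "L <#> (M \<inter> M') \<subseteq> L <#> M'" by (auto simp: set_mult_def)
  then show ?case using finite_index_normal_Int[OF M(1) M'(1)] M(2) M'(2) by blast
qed

lemma free_group_generated: "carrier (free_group X) = generate (free_group X) ((\<lambda>x. [(x, True)]) ` X)"
proof
  interpret group "free_group X" by (rule group_free_group)
  have gens: "(\<lambda>x. [(x, True)]) ` X \<subseteq> carrier (free_group X)" by (auto simp: letter_closed)
  show "generate (free_group X) ((\<lambda>x. [(x, True)]) ` X) \<subseteq> carrier (free_group X)"
    by (rule generate_incl[OF gens])
  show "carrier (free_group X) \<subseteq> generate (free_group X) ((\<lambda>x. [(x, True)]) ` X)"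
  proof
    fix w assume "w \<in> carrier (free_group X)"
    then show "w \<in> generate (free_group X) ((\<lambda>x. [(x, True)]) ` X)"
    proof (induction w)
      case Nil
      then show ?case using generate.one[of "free_group X"] by (simp add: one_free_group)
    next
      case (Cons a w)
      note a = free_group_ConsD[OF Cons.prems]
      obtain x b where ab: "a = (x, b)" by (cases a)
      have pos: "[(x, True)] \<in> generate (free_group X) ((\<lambda>x. [(x, True)]) ` X)"
        using a(1) ab by (auto intro: generate.incl)
      then have "[a] \<in> generate (free_group X) ((\<lambda>x. [(x, True)]) ` X)"
        using generate_m_inv_closed[OF gens pos] a(1) ab by (cases b) (auto simp: inv_letter)
      then show ?case using Cons.IH[OF a(2)] a(3) generate.eng by metis
    qed
  qed
qed

section \<open>Separability of finitely generated subgroups of free groups\<close>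

text \<open>In a finite set, the complements of domain and image have the same size, so any
  bijection between them completes the injection. In Hall's construction this turns the partial
  action of a generator into a permutation.\<close>

lemma injection_extends_to_Bij:
  assumes "finite V" "A \<subseteq> V" "g ` A \<subseteq> V" "inj_on g A"
  obtains f where "f \<in> Bij V" "\<And>a. a \<in> A \<Longrightarrow> f a = g a"
proof -
  have "card (V - A) = card (V - g ` A)"
    using assms by (metis card_Diff_subset card_image finite_subset)
  then obtain k where k: "bij_betw k (V - A) (V - g ` A)"
    using assms(1) by (metis finite_Diff finite_same_card_bij)
  have "bij_betw (\<lambda>x. if x \<in> A then g x else k x) (A \<union> (V - A)) (g ` A \<union> (V - g ` A))"
    using assms k by (intro bij_betw_disjoint_Un) (auto simp: bij_betw_def)
  then have "bij_betw (\<lambda>x. if x \<in> A then g x else k x) V V"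
    using assms(2,3) by (simp add: Un_absorb1)
  then have "restrict (\<lambda>x. if x \<in> A then g x else k x) V \<in> Bij V"
    by (auto simp: Bij_def cong: bij_betw_cong)
  then show thesis using that assms(2) by (auto simp: subset_iff)
qed

text \<open>Marshall Hall's theorem: the generators act partially on the finite set \<open>V\<close> of cosets met when
  tracing the words in \<open>S\<close> and \<open>b\<close>; any extension to permutations of \<open>V\<close> does.\<close>

lemma free_group_separates:
  assumes S: "finite S" "S \<subseteq> carrier (free_group X)" and P: "P = generate (free_group X) S"
    and L: "subgroup L (free_group X)" "L \<subseteq> P"
    and fin: "finite ((\<lambda>p. p <#\<^bsub>free_group X\<^esub> L) ` P)"
    and b: "b \<in> carrier (free_group X)" "b \<notin> L"
  shows "\<exists>M. finite_index_normal (free_group X) M \<and> b \<notin> L <#>\<^bsub>free_group X\<^esub> M"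
proof -
  define F where "F = free_group X"
  interpret group F unfolding F_def by (rule group_free_group)
  have sL: "subgroup L F" and LF: "L \<subseteq> carrier F" using L subgroup.subset by (auto simp: F_def)
  have sP: "subgroup P F" using P S generate_is_subgroup by (simp add: F_def)
  have PF: "p \<in> carrier F" if "p \<in> P" for p using that sP by (rule subgroup.mem_carrier[rotated])
  \<comment> \<open>Products act from the right end of a word, so tracing a word visits the
    translates by its suffixes.\<close>
  define W where "W = (\<Union>s\<in>insert b S. (\<lambda>i. drop i s) ` {..length s})"
  have "finite W" using S(1) by (simp add: W_def)
  have W_iff: "w \<in> W \<longleftrightarrow> (\<exists>u. u @ w \<in> insert b S)" for w
  proof
    assume "w \<in> W"
    then obtain s i where "s \<in> insert b S" "w = drop i s" unfolding W_def by blast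
    then show "\<exists>u. u @ w \<in> insert b S" by (intro exI[of _ "take i s"]) simp
  next
    assume "\<exists>u. u @ w \<in> insert b S"
    then obtain u where u: "u @ w \<in> insert b S" by blast
    have "w \<in> (\<lambda>i. drop i (u @ w)) ` {..length (u @ w)}"
      by (rule image_eqI[of _ _ "length u"]) simp_all
    then show "w \<in> W" unfolding W_def by (rule UN_I[OF u])
  qed
  have WF: "w \<in> carrier F" if w: "w \<in> W" for w
  proof -
    obtain u where "u @ w \<in> insert b S" using iffD1[OF W_iff w] ..
    then have "u @ w \<in> carrier F" using b(1) S(2) by (auto simp: F_def)
    then show ?thesis using reduced_appendD[of u w] by (simp add: F_def carrier_free_group image_Un)
  qed
  have W_Cons: "w \<in> W" if "a # w \<in> W" for a w
    using that unfolding W_iff by (metis append.assoc append_Cons append_Nil)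
  have WS: "S \<subseteq> W" "b \<in> W" unfolding W_iff subset_iff by (metis append_Nil insertCI)+
  define V where "V = (\<lambda>(w, C). w <#\<^bsub>F\<^esub> C) ` (W \<times> (\<lambda>p. p <#\<^bsub>F\<^esub> L) ` P)"
  have finV: "finite V" using \<open>finite W\<close> fin by (simp add: V_def F_def)
  have V: "(w \<otimes>\<^bsub>F\<^esub> p) <#\<^bsub>F\<^esub> L \<in> V" if "w \<in> W" "p \<in> P" for w p
  proof -
    have "w <#\<^bsub>F\<^esub> (p <#\<^bsub>F\<^esub> L) \<in> V"
      unfolding V_def by (rule image_eqI[of _ _ "(w, p <#\<^bsub>F\<^esub> L)"]) (use that in auto)
    then show ?thesis using lcos_m_assoc[OF LF WF PF] that by simp
  qed
  have V_sub: "C \<subseteq> carrier F" if "C \<in> V" for C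
    using that l_coset_subset_G[OF l_coset_subset_G[OF LF PF] WF] unfolding V_def by blast
  have nil: "[] \<in> W" using W_Cons WS(2) by (induction b) auto
  have oneF: "[] = \<one>\<^bsub>F\<^esub>" by (simp add: F_def one_free_group)
  have V0: "p <#\<^bsub>F\<^esub> L \<in> V" if "p \<in> P" for p
    using V[OF nil that] PF[OF that] by (simp add: oneF)
  have l_inv_act: "inv\<^bsub>F\<^esub> x <#\<^bsub>F\<^esub> (x <#\<^bsub>F\<^esub> C) = C" if "x \<in> carrier F" "C \<subseteq> carrier F" for x C
    using that by (simp add: lcos_m_assoc lcos_mult_one)
  \<comment> \<open>A generator is prescribed only where left translation stays inside
    \<open>V\<close>; there it is injective.\<close>
  have "\<exists>f. f \<in> Bij V \<and> (\<forall>C\<in>V. [(x, True)] <#\<^bsub>F\<^esub> C \<in> V \<longrightarrow> f C = [(x, True)] <#\<^bsub>F\<^esub> C)" if x: "x \<in> X" for x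
  proof -
    have xF: "[(x, True)] \<in> carrier F" using x by (simp add: F_def letter_closed)
    obtain f where "f \<in> Bij V" "\<And>C. C \<in> {C \<in> V. [(x, True)] <#\<^bsub>F\<^esub> C \<in> V} \<Longrightarrow> f C = [(x, True)] <#\<^bsub>F\<^esub> C"
    proof (rule injection_extends_to_Bij[OF finV, of "{C \<in> V. [(x, True)] <#\<^bsub>F\<^esub> C \<in> V}" "l_coset F [(x, True)]"])
      show "inj_on (l_coset F [(x, True)]) {C \<in> V. [(x, True)] <#\<^bsub>F\<^esub> C \<in> V}"
        using l_inv_act[OF xF] V_sub by (intro inj_on_inverseI[of _ "l_coset F (inv\<^bsub>F\<^esub> [(x, True)])"]) auto
    qed auto
    then show ?thesis by blast
  qed
  then obtain f where f: "\<And>x. x \<in> X \<Longrightarrow> f x \<in> Bij V"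
    and f_act: "\<And>x C. \<lbrakk>x \<in> X; C \<in> V; [(x, True)] <#\<^bsub>F\<^esub> C \<in> V\<rbrakk> \<Longrightarrow> f x C = [(x, True)] <#\<^bsub>F\<^esub> C"
    by metis
  have "f \<in> X \<rightarrow> carrier (BijGroup V)" using f by (simp add: BijGroup_def)
  from free_group_extend[OF group_BijGroup this, folded F_def]
  obtain h where h: "h \<in> hom F (BijGroup V)" and h_gen: "\<And>x. x \<in> X \<Longrightarrow> h [(x, True)] = f x"
    by (auto elim!: bexE)
  interpret h: group_hom F "BijGroup V" h
    using h by (simp add: group_hom_def group_hom_axioms_def group_BijGroup group_axioms)
  have h_Bij: "h w \<in> Bij V" if "w \<in> carrier F" for w
    using h.hom_closed[OF that] by (simp add: BijGroup_def)
  have act_mult: "h (u \<otimes>\<^bsub>F\<^esub> v) C = h u (h v C)" if "u \<in> carrier F" "v \<in> carrier F" "C \<in> V" for u v C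
    using that h.hom_mult[OF that(1,2)] h_Bij by (simp add: BijGroup_def compose_def)
  have act_one: "h \<one>\<^bsub>F\<^esub> C = C" if "C \<in> V" for C
    using that h.hom_one by (simp add: BijGroup_def)
  have act_inv: "h (inv\<^bsub>F\<^esub> u) (h u C) = C" if "u \<in> carrier F" "C \<in> V" for u C
    using that act_mult[of "inv\<^bsub>F\<^esub> u" u C] act_one by simp
  \<comment> \<open>An inverse letter also acts by translation when both cosets lie in
    \<open>V\<close>, because its generator was prescribed at the translated coset.\<close>
  have act_letter: "h [a] C = [a] <#\<^bsub>F\<^esub> C" if a: "fst a \<in> X" and C: "C \<in> V" "[a] <#\<^bsub>F\<^esub> C \<in> V" for a C
  proof -
    obtain x e where ab: "a = (x, e)" by (cases a)
    have x: "x \<in> X" using a ab by simp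
    show ?thesis
    proof (cases e)
      case True
      then show ?thesis using f_act h_gen x C ab by simp
    next
      case False
      have xF: "[(x, True)] \<in> carrier F" "inv\<^bsub>F\<^esub> [(x, True)] = [a]"
        using x ab False by (auto simp: F_def letter_closed inv_letter)
      have "[(x, True)] <#\<^bsub>F\<^esub> ([a] <#\<^bsub>F\<^esub> C) = C"
        using l_inv_act[of "[a]" C] xF V_sub[OF C(1)] by (metis inv_closed inv_inv)
      then have "h [(x, True)] ([a] <#\<^bsub>F\<^esub> C) = C"
        using f_act[OF x C(2)] h_gen[OF x] C(1) by simp
      then show ?thesis using act_inv[OF xF(1) C(2)] xF(2) by simp
    qed
  qed
  have act_word: "h w (p <#\<^bsub>F\<^esub> L) = (w \<otimes>\<^bsub>F\<^esub> p) <#\<^bsub>F\<^esub> L" if "w \<in> W" and p: "p \<in> P" for w p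
    using that(1)
  proof (induction w)
    case Nil
    then show ?case using act_one[OF V0[OF p]] PF[OF p] by (simp add: oneF)
  next
    case (Cons a w)
    have w: "w \<in> W" using W_Cons Cons.prems by blast
    note a = free_group_ConsD[OF WF[OF Cons.prems, unfolded F_def], folded F_def]
    have aF: "[a] \<in> carrier F" using a(1) by (simp add: F_def letter_closed)
    have eq: "[a] <#\<^bsub>F\<^esub> ((w \<otimes>\<^bsub>F\<^esub> p) <#\<^bsub>F\<^esub> L) = ((a # w) \<otimes>\<^bsub>F\<^esub> p) <#\<^bsub>F\<^esub> L"
      unfolding a(3) using a(2) aF PF[OF p] LF by (simp add: lcos_m_assoc m_assoc)
    have "h (a # w) (p <#\<^bsub>F\<^esub> L) = h [a] (h w (p <#\<^bsub>F\<^esub> L))"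
      unfolding a(3) by (rule act_mult[OF aF a(2) V0[OF p]])
    also have "\<dots> = h [a] ((w \<otimes>\<^bsub>F\<^esub> p) <#\<^bsub>F\<^esub> L)" using Cons.IH[OF w] by simp
    also have "\<dots> = ((a # w) \<otimes>\<^bsub>F\<^esub> p) <#\<^bsub>F\<^esub> L"
      using act_letter[OF a(1) V[OF w p]] V[OF Cons.prems p] eq by simp
    finally show ?case .
  qed
  \<comment> \<open>Words in \<open>S\<close> lead from cosets of \<open>L\<close> in
    \<open>P\<close> to such cosets and stay inside \<open>V\<close> on the way, so all of
    \<open>P\<close> acts on these cosets by left translation.\<close>
  have act_P: "h q (p <#\<^bsub>F\<^esub> L) = (q \<otimes>\<^bsub>F\<^esub> p) <#\<^bsub>F\<^esub> L" if q: "q \<in> P" and p: "p \<in> P" for q p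
    using q p unfolding P F_def[symmetric]
  proof (induction q arbitrary: p rule: generate.induct)
    case one
    then have "p \<in> P" by (simp add: P F_def)
    then show ?case using act_one V0 PF by simp
  next
    case (incl s)
    then show ?case using act_word WS(1) by (auto simp: P F_def)
  next
    case (inv s)
    have p: "p \<in> P" using inv by (simp add: P F_def)
    have s: "s \<in> P" using inv by (auto simp: P F_def intro: generate.incl)
    have q: "inv\<^bsub>F\<^esub> s \<otimes>\<^bsub>F\<^esub> p \<in> P" by (intro subgroup.m_closed[OF sP] subgroup.m_inv_closed[OF sP] s p)
    have "s \<otimes>\<^bsub>F\<^esub> (inv\<^bsub>F\<^esub> s \<otimes>\<^bsub>F\<^esub> p) = p" using PF[OF s] PF[OF p] by (simp add: m_assoc[symmetric])
    then have "h s ((inv\<^bsub>F\<^esub> s \<otimes>\<^bsub>F\<^esub> p) <#\<^bsub>F\<^esub> L) = p <#\<^bsub>F\<^esub> L" using act_word[OF _ q] WS(1) inv by auto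
    then show ?case using act_inv[OF PF[OF s] V0[OF q]] by simp
  next
    case (eng q1 q2)
    have p: "p \<in> P" and q: "q1 \<in> P" "q2 \<in> P" using eng by (auto simp: P F_def)
    have q2p: "q2 \<otimes>\<^bsub>F\<^esub> p \<in> P" by (rule subgroup.m_closed[OF sP q(2) p])
    have "h (q1 \<otimes>\<^bsub>F\<^esub> q2) (p <#\<^bsub>F\<^esub> L) = h q1 (h q2 (p <#\<^bsub>F\<^esub> L))"
      by (rule act_mult[OF PF[OF q(1)] PF[OF q(2)] V0[OF p]])
    also have "\<dots> = (q1 \<otimes>\<^bsub>F\<^esub> (q2 \<otimes>\<^bsub>F\<^esub> p)) <#\<^bsub>F\<^esub> L"
      using eng p q2p by (simp add: P F_def)
    finally show ?case using PF q p by (simp add: m_assoc)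
  qed
  have P1: "\<one>\<^bsub>F\<^esub> \<in> P" using sP by (rule subgroup.one_closed)
  have L1: "\<one>\<^bsub>F\<^esub> <#\<^bsub>F\<^esub> L = L" by (rule lcos_mult_one[OF LF])
  define M where "M = {w \<in> carrier F. h w \<in> {\<one>\<^bsub>BijGroup V\<^esub>}}"
  have "finite (carrier (BijGroup V))"
  proof (rule finite_subset)
    show "carrier (BijGroup V) \<subseteq> V \<rightarrow>\<^sub>E V"
      by (auto simp: BijGroup_def Bij_def PiE_def bij_betw_def)
  qed (use finV in \<open>auto intro: finite_PiE\<close>)
  then have "finite (rcosets\<^bsub>BijGroup V\<^esub> {\<one>\<^bsub>BijGroup V\<^esub>})"
    by (simp add: RCOSETS_def)
  then have "finite_index_normal (BijGroup V) {\<one>\<^bsub>BijGroup V\<^esub>}"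
    using h.H.one_is_normal by (simp add: finite_index_normal_def)
  then have "finite_index_normal F M" unfolding M_def by (rule h.finite_index_normal_vimage)
  \<comment> \<open>If \<open>b\<close> were \<open>l\<close> times an element of the kernel
    \<open>M\<close>, then \<open>h b\<close> would fix the coset \<open>L\<close> as
    \<open>h l\<close> does. But \<open>h b\<close> carries \<open>L\<close> to its true translate
    by \<open>b\<close>, so \<open>b\<close> would lie in \<open>L\<close>.\<close>
  moreover have "b \<notin> L <#>\<^bsub>F\<^esub> M"
  proof
    assume "b \<in> L <#>\<^bsub>F\<^esub> M"
    then obtain l m where lm: "l \<in> L" "m \<in> M" "b = l \<otimes>\<^bsub>F\<^esub> m" by (auto simp: set_mult_def)
    have c: "l \<in> carrier F" "m \<in> carrier F" "l \<in> P" "L \<in> V" "h m = \<one>\<^bsub>BijGroup V\<^esub>"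
      using lm LF L(2) V0[OF P1] L1 by (auto simp: M_def)
    have "h b L = h l L"
      using act_mult[OF c(1,2,4)] lm(3) c act_one[OF c(4)] h.hom_one by simp
    also have "\<dots> = l <#\<^bsub>F\<^esub> L" using act_P[OF c(3) P1] L1 c(1) by simp
    also have "\<dots> = L" by (rule coset_join3[OF c(1) sL lm(1)])
    finally have "b <#\<^bsub>F\<^esub> L = \<one>\<^bsub>F\<^esub> <#\<^bsub>F\<^esub> L" using act_word[OF WS(2) P1] L1 WF[OF WS(2)] by simp
    then have "inv\<^bsub>F\<^esub> b \<in> L" using l_coset_eq_iff[OF sL, of b "\<one>\<^bsub>F\<^esub>"] WF[OF WS(2)] by simp
    then show False using subgroup.m_inv_closed[OF sL, of "inv\<^bsub>F\<^esub> b"] WF[OF WS(2)] b(2) by simp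
  qed
  ultimately show ?thesis by (auto simp: F_def)
qed

section \<open>Separability in products\<close>

text \<open>Hall's theorem is applied to the finitely many coset representatives of \<open>L\<close>
  in \<open>P\<close> that lie outside \<open>L\<close>, and, with \<open>P\<close> in place of
  \<open>L\<close>, to the point \<open>a\<close>. The resulting subgroups are intersected.\<close>

lemma free_group_separates_finite_index:
  assumes S: "finite S" "S \<subseteq> carrier (free_group X)" and P: "P = generate (free_group X) S"
    and L: "subgroup L (free_group X)" "L \<subseteq> P"
    and fin: "finite ((\<lambda>p. p <#\<^bsub>free_group X\<^esub> L) ` P)"
    and a: "a \<in> carrier (free_group X)"
  obtains M where "finite_index_normal (free_group X) M" "M \<inter> P \<subseteq> L"
    "a \<in> P <#>\<^bsub>free_group X\<^esub> M \<longrightarrow> a \<in> P"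
proof -
  define F where "F = free_group X"
  interpret group F unfolding F_def by (rule group_free_group)
  have sL: "subgroup L F" using L by (simp add: F_def)
  have sP: "subgroup P F" using P S generate_is_subgroup by (simp add: F_def)
  have PF: "p \<in> carrier F" if "p \<in> P" for p using that sP by (rule subgroup.mem_carrier[rotated])
  obtain C where C: "C \<subseteq> P" "finite C" "(\<lambda>p. p <#\<^bsub>F\<^esub> L) ` P = (\<lambda>p. p <#\<^bsub>F\<^esub> L) ` C"
    using finite_subset_image[OF fin order_refl] by (auto simp: F_def)
  have "\<exists>M. finite_index_normal F M \<and> (\<forall>c\<in>C - L. c \<notin> L <#>\<^bsub>F\<^esub> M)"
  proof (rule finite_index_normal_separates_finite)
    fix c assume "c \<in> C - L"
    then show "\<exists>M. finite_index_normal F M \<and> c \<notin> L <#>\<^bsub>F\<^esub> M"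
      using free_group_separates[OF S P L fin] C(1) PF by (auto simp: F_def)
  qed (use C in simp)
  then obtain M1 where M1: "finite_index_normal F M1" "\<And>c. c \<in> C \<Longrightarrow> c \<notin> L \<Longrightarrow> c \<notin> L <#>\<^bsub>F\<^esub> M1" by auto
  have "\<exists>M. finite_index_normal F M \<and> (a \<in> P <#>\<^bsub>F\<^esub> M \<longrightarrow> a \<in> P)"
  proof (cases "a \<in> P")
    case False
    have "(\<lambda>p. p <#\<^bsub>F\<^esub> P) ` P \<subseteq> {P}"
      using PF by (auto simp: coset_join3[OF _ sP])
    then have "finite ((\<lambda>p. p <#\<^bsub>free_group X\<^esub> P) ` P)" by (auto simp: F_def intro: finite_subset)
    then show ?thesis
      using free_group_separates[OF S P sP[unfolded F_def] order_refl _ a False] by (auto simp: F_def)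
  qed (use finite_index_normal_carrier in blast)
  then obtain M2 where M2: "finite_index_normal F M2" "a \<in> P <#>\<^bsub>F\<^esub> M2 \<Longrightarrow> a \<in> P" by blast
  have nM1: "M1 \<lhd> F" using M1 by (simp add: finite_index_normal_def)
  \<comment> \<open>The representative \<open>c\<close> of the coset of \<open>m\<close> lies in the
    product of \<open>M1\<close> and \<open>L\<close>, so it is not separated from \<open>L\<close>.
    Therefore it lies in \<open>L\<close>, and so does \<open>m\<close>.\<close>
  have "m \<in> L" if m: "m \<in> M1" "m \<in> P" for m
  proof -
    obtain c where c: "c \<in> C" "m <#\<^bsub>F\<^esub> L = c <#\<^bsub>F\<^esub> L" using C(3) m(2) by (metis (no_types, lifting) image_iff)
    have cF: "c \<in> carrier F" and mF: "m \<in> carrier F" using c(1) C(1) m(2) PF by auto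
    have "c \<in> m <#\<^bsub>F\<^esub> L" using l_coset_self[OF sL cF] c(2) by simp
    then have "c \<in> M1 <#>\<^bsub>F\<^esub> L" using m(1) by (auto simp: l_coset_def set_mult_def)
    then have "c \<in> L <#>\<^bsub>F\<^esub> M1" using commut_normal[OF sL nM1] by simp
    then have "c \<in> L" using M1(2)[OF c(1)] by blast
    then have "m <#\<^bsub>F\<^esub> L = L" using c(2) coset_join3[OF cF sL] by simp
    then show "m \<in> L" using l_coset_self[OF sL mF] by simp
  qed
  then have "(M1 \<inter> M2) \<inter> P \<subseteq> L" by blast
  moreover have "a \<in> P" if "a \<in> P <#>\<^bsub>F\<^esub> (M1 \<inter> M2)"
    using that by (intro M2(2)) (auto simp: set_mult_def)
  ultimately show thesis
    using that[of "M1 \<inter> M2"] finite_index_normal_Int[OF M1(1) M2(1)] by (simp add: F_def)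
qed

text \<open>Choose \<open>M1\<close> and \<open>M2\<close> for the two coordinates of
  \<open>x\<close>. If \<open>x\<close> is \<open>h\<close> times \<open>m\<close> with the
  coordinates of \<open>m\<close> in these, then the coordinates of \<open>x\<close>, and so those
  of \<open>m\<close>, lie in the generated subgroups. Those of \<open>m\<close> are then in
  \<open>L1\<close> and \<open>L2\<close>, which forces \<open>m\<close> and with it
  \<open>x\<close> into \<open>H\<close>.\<close>

lemma separable_if_finite_index:
  assumes "group_hom G (free_group X) \<theta>" and "group_hom G (free_group Y) \<eta>"
    and H: "subgroup H G"
    and S1: "finite S1" "S1 \<subseteq> carrier (free_group X)" "\<theta> ` H \<subseteq> generate (free_group X) S1"
    and S2: "finite S2" "S2 \<subseteq> carrier (free_group Y)" "\<eta> ` H \<subseteq> generate (free_group Y) S2"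
    and L1: "subgroup L1 (free_group X)" "L1 \<subseteq> generate (free_group X) S1"
      "finite ((\<lambda>p. p <#\<^bsub>free_group X\<^esub> L1) ` generate (free_group X) S1)"
    and L2: "subgroup L2 (free_group Y)" "L2 \<subseteq> generate (free_group Y) S2"
      "finite ((\<lambda>p. p <#\<^bsub>free_group Y\<^esub> L2) ` generate (free_group Y) S2)"
    and LH: "\<And>g. \<lbrakk>g \<in> carrier G; \<theta> g \<in> L1; \<eta> g \<in> L2\<rbrakk> \<Longrightarrow> g \<in> H"
    and x: "x \<in> carrier G" "x \<notin> H"
  shows "\<exists>M. finite_index_normal G M \<and> x \<notin> H <#>\<^bsub>G\<^esub> M"
proof -
  interpret \<theta>: group_hom G "free_group X" \<theta> by fact
  interpret \<eta>: group_hom G "free_group Y" \<eta> by fact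
  obtain M1 where M1: "finite_index_normal (free_group X) M1" "M1 \<inter> generate (free_group X) S1 \<subseteq> L1"
    "\<theta> x \<in> generate (free_group X) S1 <#>\<^bsub>free_group X\<^esub> M1 \<longrightarrow> \<theta> x \<in> generate (free_group X) S1"
    by (rule free_group_separates_finite_index[OF S1(1,2) refl L1 \<theta>.hom_closed[OF x(1)]])
  obtain M2 where M2: "finite_index_normal (free_group Y) M2" "M2 \<inter> generate (free_group Y) S2 \<subseteq> L2"
    "\<eta> x \<in> generate (free_group Y) S2 <#>\<^bsub>free_group Y\<^esub> M2 \<longrightarrow> \<eta> x \<in> generate (free_group Y) S2"
    by (rule free_group_separates_finite_index[OF S2(1,2) refl L2 \<eta>.hom_closed[OF x(1)]])
  define M where "M = {g \<in> carrier G. \<theta> g \<in> M1} \<inter> {g \<in> carrier G. \<eta> g \<in> M2}"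
  have "finite_index_normal G M"
    unfolding M_def by (intro \<theta>.G.finite_index_normal_Int \<theta>.finite_index_normal_vimage
        \<eta>.finite_index_normal_vimage M1 M2)
  moreover have "x \<notin> H <#>\<^bsub>G\<^esub> M"
  proof
    assume "x \<in> H <#>\<^bsub>G\<^esub> M"
    then obtain h m where hm: "h \<in> H" "m \<in> M" "x = h \<otimes>\<^bsub>G\<^esub> m" by (auto simp: set_mult_def)
    have c: "h \<in> carrier G" "m \<in> carrier G" "\<theta> m \<in> M1" "\<eta> m \<in> M2"
      using hm subgroup.mem_carrier[OF H] by (auto simp: M_def)
    have h: "\<theta> h \<in> generate (free_group X) S1" "\<eta> h \<in> generate (free_group Y) S2"
      using hm(1) S1(3) S2(3) by auto
    have m: "\<theta> m = inv\<^bsub>free_group X\<^esub> \<theta> h \<otimes>\<^bsub>free_group X\<^esub> \<theta> x"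
      "\<eta> m = inv\<^bsub>free_group Y\<^esub> \<eta> h \<otimes>\<^bsub>free_group Y\<^esub> \<eta> x"
      using c hm(3) by (simp_all add: \<theta>.H.m_assoc[symmetric] \<eta>.H.m_assoc[symmetric])
    have "\<theta> x \<in> generate (free_group X) S1 <#>\<^bsub>free_group X\<^esub> M1"
      "\<eta> x \<in> generate (free_group Y) S2 <#>\<^bsub>free_group Y\<^esub> M2"
      using hm(3) h c by (auto simp: set_mult_def)
    then have "\<theta> m \<in> generate (free_group X) S1" "\<eta> m \<in> generate (free_group Y) S2"
      unfolding m using M1(3) M2(3) h \<theta>.H.generate_m_inv_closed[OF S1(2)] \<eta>.H.generate_m_inv_closed[OF S2(2)]
      by (auto intro!: generate.eng)
    then have "m \<in> H" using M1(2) M2(2) c by (intro LH) auto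
    then show False using hm x(2) subgroup.m_closed[OF H] by auto
  qed
  ultimately show ?thesis by blast
qed

text \<open>Here \<open>\<eta>\<close> is injective on \<open>H\<close>. Residual finiteness of the
  first factor gives \<open>N\<close>, and \<open>H\<close> is enlarged by \<open>N'\<close>, the
  part of the kernel of \<open>\<eta>\<close> lying over \<open>N\<close>. The larger group still
  misses \<open>x\<close> and contains every point with coordinates in \<open>N\<close> and in the
  image of \<open>H0\<close>, so \<open>separable_if_finite_index\<close> applies.\<close>

lemma separable_if_trivial_kernel:
  assumes \<theta>: "group_hom G (free_group X) \<theta>" and \<eta>: "group_hom G (free_group Y) \<eta>"
    and inj: "\<And>g. \<lbrakk>g \<in> carrier G; \<theta> g = \<one>\<^bsub>free_group X\<^esub>; \<eta> g = \<one>\<^bsub>free_group Y\<^esub>\<rbrakk> \<Longrightarrow> g = \<one>\<^bsub>G\<^esub>"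
    and "finite X" and H: "subgroup H G"
    and S2: "finite S2" "S2 \<subseteq> carrier (free_group Y)" "\<eta> ` H = generate (free_group Y) S2"
    and triv: "\<And>h. \<lbrakk>h \<in> H; \<eta> h = \<one>\<^bsub>free_group Y\<^esub>\<rbrakk> \<Longrightarrow> h = \<one>\<^bsub>G\<^esub>"
    and x: "x \<in> carrier G" "x \<notin> H"
  shows "\<exists>M. finite_index_normal G M \<and> x \<notin> H <#>\<^bsub>G\<^esub> M"
proof -
  define A where "A = free_group X"
  define B where "B = free_group Y"
  interpret \<theta>: group_hom G A \<theta> using \<theta> by (simp add: A_def)
  interpret \<eta>: group_hom G B \<eta> using \<eta> by (simp add: B_def)
  have HG: "h \<in> carrier G" if "h \<in> H" for h using that H by (rule subgroup.mem_carrier[rotated])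
  \<comment> \<open>At most one element of \<open>H\<close> has the second coordinate of
    \<open>x\<close>. If it exists, \<open>N\<close> excludes the first coordinate of its quotient
    with \<open>x\<close>; otherwise \<open>N\<close> is the whole group.\<close>
  obtain N where N: "finite_index_normal A N"
    and xN: "\<And>h. \<lbrakk>h \<in> H; \<eta> h = \<eta> x\<rbrakk> \<Longrightarrow> \<theta> (x \<otimes>\<^bsub>G\<^esub> inv\<^bsub>G\<^esub> h) \<notin> N"
  proof (cases "\<eta> x \<in> \<eta> ` H")
    case True
    then obtain h0 where h0: "h0 \<in> H" "\<eta> h0 = \<eta> x" by auto
    have h0G: "h0 \<in> carrier G" by (rule HG[OF h0(1)])
    have uniq: "h = h0" if h: "h \<in> H" "\<eta> h = \<eta> x" for h
    proof -
      have "h \<otimes>\<^bsub>G\<^esub> inv\<^bsub>G\<^esub> h0 = \<one>\<^bsub>G\<^esub>"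
        using h h0 HG subgroup.m_closed[OF H] subgroup.m_inv_closed[OF H] x(1)
        by (intro triv) (auto simp flip: B_def)
      then show ?thesis using HG[OF h(1)] h0G \<theta>.G.inv_equality[of h "inv\<^bsub>G\<^esub> h0"] by simp
    qed
    let ?z = "x \<otimes>\<^bsub>G\<^esub> inv\<^bsub>G\<^esub> h0"
    have z: "\<theta> ?z \<noteq> \<one>\<^bsub>A\<^esub>"
    proof
      assume "\<theta> ?z = \<one>\<^bsub>A\<^esub>"
      moreover have "\<eta> ?z = \<one>\<^bsub>B\<^esub>" using h0 h0G x(1) by simp
      ultimately have "?z = \<one>\<^bsub>G\<^esub>" using x(1) h0G by (intro inj) (auto simp: A_def B_def)
      then have "x = h0" using x(1) h0G \<theta>.G.inv_equality[of x "inv\<^bsub>G\<^esub> h0"] by simp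
      then show False using x(2) h0(1) by simp
    qed
    \<comment> \<open>Residual finiteness is Hall's theorem for the trivial subgroup, generated by
      the empty set.\<close>
    have gen1: "{\<one>\<^bsub>A\<^esub>} = generate A {}" by (simp add: \<theta>.H.generate_empty)
    have zA: "\<theta> ?z \<in> carrier A" using x(1) h0G by simp
    have "\<exists>M. finite_index_normal A M \<and> \<theta> ?z \<notin> {\<one>\<^bsub>A\<^esub>} <#>\<^bsub>A\<^esub> M"
      unfolding A_def
      by (rule free_group_separates[of "{}", OF _ _ gen1[unfolded A_def]])
        (use z zA \<theta>.H.triv_subgroup in \<open>simp_all add: A_def del: \<theta>.hom_mult\<close>)
    then obtain M where M: "finite_index_normal A M" "\<theta> ?z \<notin> {\<one>\<^bsub>A\<^esub>} <#>\<^bsub>A\<^esub> M" by blast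
    then have "\<theta> ?z \<notin> M" using x(1) h0G by (force simp: set_mult_def)
    then show thesis using that[OF M(1)] uniq by blast
  next
    case False
    then show thesis using that[OF \<theta>.H.finite_index_normal_carrier] by (metis imageI)
  qed
  have nN: "N \<lhd> A" and sN: "subgroup N A" using N by (auto simp: finite_index_normal_def normal_imp_subgroup)
  define N' where "N' = {g \<in> carrier G. \<theta> g \<in> N} \<inter> kernel G B \<eta>"
  have nN': "N' \<lhd> G"
    unfolding N'_def
  proof (rule \<theta>.G.normal_subgroup_intersect)
    show "{g \<in> carrier G. \<theta> g \<in> N} \<lhd> G"
      using \<theta>.finite_index_normal_vimage[OF N] by (simp add: finite_index_normal_def)
  qed (rule \<eta>.normal_kernel)
  have sHN: "subgroup (N' <#>\<^bsub>G\<^esub> H) G" by (rule \<theta>.G.mult_norm_subgroup[OF nN' H])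
  have HN_iff: "g \<in> N' <#>\<^bsub>G\<^esub> H \<longleftrightarrow> g \<in> carrier G \<and> (\<exists>h\<in>H. \<eta> h = \<eta> g \<and> \<theta> (g \<otimes>\<^bsub>G\<^esub> inv\<^bsub>G\<^esub> h) \<in> N)" for g
  proof
    assume "g \<in> N' <#>\<^bsub>G\<^esub> H"
    then obtain n h where nh: "n \<in> N'" "h \<in> H" "g = n \<otimes>\<^bsub>G\<^esub> h" by (auto simp: set_mult_def)
    then have "g \<otimes>\<^bsub>G\<^esub> inv\<^bsub>G\<^esub> h = n" "n \<in> carrier G" "h \<in> carrier G"
      using HG by (auto simp: N'_def \<theta>.G.m_assoc)
    then show "g \<in> carrier G \<and> (\<exists>h\<in>H. \<eta> h = \<eta> g \<and> \<theta> (g \<otimes>\<^bsub>G\<^esub> inv\<^bsub>G\<^esub> h) \<in> N)"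
      using nh by (auto simp: N'_def kernel_def intro!: bexI[of _ h])
  next
    assume "g \<in> carrier G \<and> (\<exists>h\<in>H. \<eta> h = \<eta> g \<and> \<theta> (g \<otimes>\<^bsub>G\<^esub> inv\<^bsub>G\<^esub> h) \<in> N)"
    then obtain h where h: "g \<in> carrier G" "h \<in> H" "\<eta> h = \<eta> g" "\<theta> (g \<otimes>\<^bsub>G\<^esub> inv\<^bsub>G\<^esub> h) \<in> N" by blast
    have "g \<otimes>\<^bsub>G\<^esub> inv\<^bsub>G\<^esub> h \<in> N'" "g = (g \<otimes>\<^bsub>G\<^esub> inv\<^bsub>G\<^esub> h) \<otimes>\<^bsub>G\<^esub> h"
      using h HG[OF h(2)] by (auto simp: N'_def kernel_def \<theta>.G.m_assoc)
    then show "g \<in> N' <#>\<^bsub>G\<^esub> H" using h(2) by (auto simp: set_mult_def)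
  qed
  define H0 where "H0 = {h \<in> H. \<theta> h \<in> N}"
  have sH0: "subgroup H0 G"
  proof -
    have "H0 = H \<inter> {g \<in> carrier G. \<theta> g \<in> N}" using HG by (auto simp: H0_def)
    then show ?thesis using \<theta>.G.subgroups_Inter_pair[OF H \<theta>.subgroup_vimage[OF sN]] by simp
  qed
  have sL2: "subgroup (\<eta> ` H0) B" by (rule \<eta>.subgroup_img_is_subgroup[OF sH0])
  have fin_lcosets: "finite ((\<lambda>a. a <#\<^bsub>A\<^esub> N) ` carrier A)"
  proof -
    have "(\<lambda>a. a <#\<^bsub>A\<^esub> N) ` carrier A \<subseteq> rcosets\<^bsub>A\<^esub> N"
      using normal.coset_eq[OF nN] by (auto simp: RCOSETS_def)
    then show ?thesis using N by (auto simp: finite_index_normal_def intro: finite_subset)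
  qed
  \<comment> \<open>The coset of \<open>\<eta> h\<close> is determined by the coset of
    \<open>\<theta> h\<close> modulo \<open>N\<close>, for which there are finitely many
    choices.\<close>
  have "finite ((\<lambda>h. \<eta> h <#\<^bsub>B\<^esub> \<eta> ` H0) ` H)"
  proof (rule finite_image_factor)
    show "finite ((\<lambda>h. \<theta> h <#\<^bsub>A\<^esub> N) ` H)"
      by (rule finite_subset[OF _ fin_lcosets]) (use HG in auto)
    fix h k assume hk: "h \<in> H" "k \<in> H" "\<theta> h <#\<^bsub>A\<^esub> N = \<theta> k <#\<^bsub>A\<^esub> N"
    have c: "h \<in> carrier G" "k \<in> carrier G" using hk HG by auto
    have "\<theta> (inv\<^bsub>G\<^esub> h \<otimes>\<^bsub>G\<^esub> k) \<in> N"
      using hk(3) c \<theta>.H.l_coset_eq_iff[OF sN, of "\<theta> h" "\<theta> k"] by simp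
    then have "inv\<^bsub>G\<^esub> h \<otimes>\<^bsub>G\<^esub> k \<in> H0"
      using hk(1,2) by (simp add: H0_def subgroup.m_closed[OF H] subgroup.m_inv_closed[OF H])
    then have "\<eta> (inv\<^bsub>G\<^esub> h \<otimes>\<^bsub>G\<^esub> k) \<in> \<eta> ` H0" by (rule imageI)
    then show "\<eta> h <#\<^bsub>B\<^esub> \<eta> ` H0 = \<eta> k <#\<^bsub>B\<^esub> \<eta> ` H0"
      using c \<eta>.H.l_coset_eq_iff[OF sL2, of "\<eta> h" "\<eta> k"] by simp
  qed
  then have fin2: "finite ((\<lambda>p. p <#\<^bsub>B\<^esub> \<eta> ` H0) ` \<eta> ` H)" by (simp add: image_image)
  have genA: "generate (free_group X) ((\<lambda>x. [(x, True)]) ` X) = carrier A"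
    by (simp add: A_def free_group_generated[of X])
  have "\<exists>M. finite_index_normal G M \<and> x \<notin> (N' <#>\<^bsub>G\<^esub> H) <#>\<^bsub>G\<^esub> M"
  proof (rule separable_if_finite_index[OF \<theta> \<eta> sHN, of "(\<lambda>x. [(x, True)]) ` X" S2 N "\<eta> ` H0"])
    show "\<theta> ` (N' <#>\<^bsub>G\<^esub> H) \<subseteq> generate (free_group X) ((\<lambda>x. [(x, True)]) ` X)"
      unfolding genA unfolding A_def[symmetric] using HN_iff by auto
    show "\<eta> ` (N' <#>\<^bsub>G\<^esub> H) \<subseteq> generate (free_group Y) S2"
      unfolding S2(3)[symmetric]
    proof (rule image_subsetI)
      fix g assume "g \<in> N' <#>\<^bsub>G\<^esub> H"
      then obtain h where "h \<in> H" "\<eta> h = \<eta> g" using HN_iff by blast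
      then show "\<eta> g \<in> \<eta> ` H" by (metis imageI)
    qed
    show "N \<subseteq> generate (free_group X) ((\<lambda>x. [(x, True)]) ` X)"
      unfolding genA unfolding A_def[symmetric] by (rule subgroup.subset[OF sN])
    show "finite ((\<lambda>p. p <#\<^bsub>free_group X\<^esub> N) ` generate (free_group X) ((\<lambda>x. [(x, True)]) ` X))"
      unfolding genA unfolding A_def[symmetric] by (rule fin_lcosets)
    show "\<eta> ` H0 \<subseteq> generate (free_group Y) S2" unfolding S2(3)[symmetric] by (auto simp: H0_def)
    show "finite ((\<lambda>p. p <#\<^bsub>free_group Y\<^esub> \<eta> ` H0) ` generate (free_group Y) S2)"
      unfolding S2(3)[symmetric] unfolding B_def[symmetric] by (rule fin2)
    show "g \<in> N' <#>\<^bsub>G\<^esub> H" if g: "g \<in> carrier G" "\<theta> g \<in> N" "\<eta> g \<in> \<eta> ` H0" for g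
    proof -
      obtain h where h: "h \<in> H" "\<theta> h \<in> N" "\<eta> h = \<eta> g" using g(3) by (auto simp: H0_def)
      have "\<theta> (g \<otimes>\<^bsub>G\<^esub> inv\<^bsub>G\<^esub> h) \<in> N"
        using g(1,2) h HG by (simp add: subgroup.m_closed[OF sN] subgroup.m_inv_closed[OF sN])
      then show ?thesis using g(1) h by (auto simp: HN_iff)
    qed
    show "x \<notin> N' <#>\<^bsub>G\<^esub> H" using xN by (auto simp: HN_iff)
  qed (use \<open>finite X\<close> S2 x sN sL2 in \<open>auto simp: A_def B_def letter_closed\<close>)
  moreover have "H \<subseteq> N' <#>\<^bsub>G\<^esub> H"
  proof
    fix h assume "h \<in> H"
    then show "h \<in> N' <#>\<^bsub>G\<^esub> H"
      unfolding HN_iff using HG subgroup.one_closed[OF sN] by (auto intro!: bexI[of _ h])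
  qed
  ultimately show ?thesis by (meson mono_set_mult order_refl subset_iff)
qed

section \<open>Finitely presented subgroups\<close>

lemma finitely_presentedE:
  assumes "finitely_presented K"
  obtains n :: nat and R \<pi> where "finite R" "R \<subseteq> carrier (free_group {..<n})"
    "group_hom (free_group {..<n}) K \<pi>" "\<pi> ` carrier (free_group {..<n}) = carrier K"
    "kernel (free_group {..<n}) K \<pi> = normal_closure (free_group {..<n}) R"
proof -
  obtain n :: nat and R where K: "group K" and R: "finite R" "R \<subseteq> carrier (free_group {..<n})"
    and iso: "K \<cong> free_group {..<n} Mod normal_closure (free_group {..<n}) R"
    using assms by (auto simp: finitely_presented_def)
  define F where "F = free_group {..<n}"
  define C where "C = normal_closure F R"
  interpret F: group F unfolding F_def by (rule group_free_group)
  interpret K: group K by (rule K)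
  have nC: "C \<lhd> F" unfolding C_def by (rule F.normal_closure_normal) (use R in \<open>simp add: F_def\<close>)
  interpret C: normal C F by (rule nC)
  obtain \<psi> where "\<psi> \<in> iso K (F Mod C)" using iso by (auto simp: is_iso_def F_def C_def)
  then obtain \<rho> where \<rho>: "\<rho> \<in> iso (F Mod C) K" using K.iso_set_sym by blast
  interpret \<rho>: group_hom "F Mod C" K \<rho>
    using \<rho> K C.factorgroup_is_group by (simp add: group_hom_def group_hom_axioms_def iso_def)
  define \<pi> where "\<pi> w = \<rho> (C #>\<^bsub>F\<^esub> w)" for w
  have \<pi>: "group_hom F K \<pi>"
  proof
    show "\<pi> \<in> hom F K"
      using hom_compose[OF C.r_coset_hom_Mod \<rho>.homh] by (simp add: \<pi>_def[abs_def] comp_def)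
  qed
  have surj: "\<pi> ` carrier F = carrier K"
    using \<rho> by (auto simp: \<pi>_def iso_def bij_betw_def carrier_FactGroup image_image)
  have "\<pi> w = \<one>\<^bsub>K\<^esub> \<longleftrightarrow> w \<in> C" if w: "w \<in> carrier F" for w
  proof -
    have "\<pi> w = \<one>\<^bsub>K\<^esub> \<longleftrightarrow> \<rho> (C #>\<^bsub>F\<^esub> w) = \<rho> \<one>\<^bsub>F Mod C\<^esub>" using \<rho>.hom_one by (simp add: \<pi>_def)
    also have "\<dots> \<longleftrightarrow> C #>\<^bsub>F\<^esub> w = C"
      using \<rho> \<rho>.G.one_closed w unfolding one_FactGroup
      by (intro inj_on_eq_iff[of \<rho> "carrier (F Mod C)"]) (auto simp: iso_def bij_betw_def carrier_FactGroup)
    also have "\<dots> \<longleftrightarrow> w \<in> C"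
      using F.coset_join1[OF _ w] F.coset_join2[OF w] C.subgroup_axioms C.subset by blast
    finally show ?thesis .
  qed
  then have "kernel F K \<pi> = C" using C.subset by (auto simp: kernel_def)
  then show thesis using that[OF R] \<pi> surj by (simp add: F_def C_def)
qed

text \<open>A jointly injective pair of homomorphisms stands for the direct product. This makes the
  factors interchangeable, so each lemma on one kernel serves for the other with the roles
  swapped.\<close>

lemma closed_if_finitely_presented:
  assumes \<theta>: "group_hom G (free_group X) \<theta>" and \<eta>: "group_hom G (free_group Y) \<eta>"
    and inj: "\<And>g. \<lbrakk>g \<in> carrier G; \<theta> g = \<one>\<^bsub>free_group X\<^esub>; \<eta> g = \<one>\<^bsub>free_group Y\<^esub>\<rbrakk> \<Longrightarrow> g = \<one>\<^bsub>G\<^esub>"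
    and fin: "finite X" "finite Y"
    and H: "subgroup H G" and fp: "finitely_presented (G\<lparr>carrier := H\<rparr>)"
  shows "closedin (profinite_topology G) H"
proof -
  define A where "A = free_group X"
  define B where "B = free_group Y"
  define K where "K = G\<lparr>carrier := H\<rparr>"
  interpret \<theta>: group_hom G A \<theta> using \<theta> by (simp add: A_def)
  interpret \<eta>: group_hom G B \<eta> using \<eta> by (simp add: B_def)
  have HG: "h \<in> carrier G" if "h \<in> H" for h using that H by (rule subgroup.mem_carrier[rotated])
  have gK: "group K" unfolding K_def by (rule \<theta>.G.subgroup_imp_group[OF H])
  have \<theta>K: "group_hom K A \<theta>" and \<eta>K: "group_hom K B \<eta>"
    using gK \<theta>.H.group_axioms \<eta>.H.group_axioms HG
    by (auto simp: group_hom_def group_hom_axioms_def hom_def K_def)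
  obtain n :: nat and R \<pi> where R: "finite R" "R \<subseteq> carrier (free_group {..<n})"
    and \<pi>: "group_hom (free_group {..<n}) K \<pi>" "\<pi> ` carrier (free_group {..<n}) = carrier K"
      "kernel (free_group {..<n}) K \<pi> = normal_closure (free_group {..<n}) R"
    by (rule finitely_presentedE[OF fp[folded K_def]])
  \<comment> \<open>The images of the free generators generate \<open>H\<close>, so both projections
    of \<open>H\<close> are finitely generated.\<close>
  define gens where "gens = \<pi> ` (\<lambda>i. [(i, True)]) ` {..<n}"
  have gens: "finite gens" "gens \<subseteq> carrier K" "generate K gens = carrier K"
  proof -
    have sub: "(\<lambda>i. [(i, True)]) ` {..<n} \<subseteq> carrier (free_group {..<n})" by (auto simp: letter_closed)
    show "generate K gens = carrier K"
      unfolding gens_def group_hom.generate_img[OF \<pi>(1) sub] free_group_generated[symmetric] by (rule \<pi>(2))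
    show "gens \<subseteq> carrier K" unfolding gens_def using \<pi>(2) sub by blast
  qed (simp add: gens_def)
  have \<theta>H: "generate A (\<theta> ` gens) = \<theta> ` H" "\<theta> ` gens \<subseteq> carrier A"
    and \<eta>H: "generate B (\<eta> ` gens) = \<eta> ` H" "\<eta> ` gens \<subseteq> carrier B"
    using group_hom.generate_img[OF \<theta>K gens(2)] group_hom.generate_img[OF \<eta>K gens(2)] gens HG
    by (auto simp: K_def)
  define N1 where "N1 = kernel K A \<theta>"
  define N2 where "N2 = kernel K B \<eta>"
  have N1_iff: "g \<in> N1 \<longleftrightarrow> g \<in> H \<and> \<theta> g = \<one>\<^bsub>A\<^esub>" and N2_iff: "g \<in> N2 \<longleftrightarrow> g \<in> H \<and> \<eta> g = \<one>\<^bsub>B\<^esub>" for g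
    by (auto simp: N1_def N2_def kernel_def K_def)
  have eqI: "x = y" if "x \<in> carrier G" "y \<in> carrier G" "\<theta> x = \<theta> y" "\<eta> x = \<eta> y" for x y
  proof -
    have "x \<otimes>\<^bsub>G\<^esub> inv\<^bsub>G\<^esub> y = \<one>\<^bsub>G\<^esub>" using that by (intro inj) (simp_all flip: A_def B_def)
    then show ?thesis using that \<theta>.G.inv_equality[of x "inv\<^bsub>G\<^esub> y"] by simp
  qed
  have sep: "\<exists>M. finite_index_normal G M \<and> x \<notin> H <#>\<^bsub>G\<^esub> M" if x: "x \<in> carrier G" "x \<notin> H" for x
  proof -
    consider "\<theta> ` N2 = {\<one>\<^bsub>A\<^esub>}" | "\<eta> ` N1 = {\<one>\<^bsub>B\<^esub>}" | "\<theta> ` N2 \<noteq> {\<one>\<^bsub>A\<^esub>}" "\<eta> ` N1 \<noteq> {\<one>\<^bsub>B\<^esub>}" by blast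
    then show ?thesis
    proof cases
      case 1
      show ?thesis
      proof (rule separable_if_trivial_kernel[OF \<theta> \<eta> inj fin(1) H _ _ _ _ x])
        show "h = \<one>\<^bsub>G\<^esub>" if "h \<in> H" "\<eta> h = \<one>\<^bsub>free_group Y\<^esub>" for h
        proof (rule inj)
          have "h \<in> N2" using that by (simp add: N2_iff B_def)
          then show "\<theta> h = \<one>\<^bsub>free_group X\<^esub>" using 1 by (auto simp: A_def)
        qed (use that HG in auto)
      qed (use gens(1) \<eta>H in \<open>auto simp: B_def\<close>)
    next
      case 2
      show ?thesis
      proof (rule separable_if_trivial_kernel[OF \<eta> \<theta> inj fin(2) H _ _ _ _ x])
        show "h = \<one>\<^bsub>G\<^esub>" if "h \<in> H" "\<theta> h = \<one>\<^bsub>free_group X\<^esub>" for h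
        proof (rule inj)
          have "h \<in> N1" using that by (simp add: N1_iff A_def)
          then show "\<eta> h = \<one>\<^bsub>free_group Y\<^esub>" using 2 by (auto simp: B_def)
        qed (use that HG in auto)
      qed (use gens(1) \<theta>H in \<open>auto simp: A_def\<close>)
    next
      case 3
      \<comment> \<open>In each coordinate one of the two elements is trivial, so the products in
        either order agree in both coordinates.\<close>
      have comm: "h \<otimes>\<^bsub>K\<^esub> k = k \<otimes>\<^bsub>K\<^esub> h" if "h \<in> N1" "k \<in> N2" for h k
        unfolding K_def using that HG by (simp add: N1_iff N2_iff) (intro eqI, auto)
      obtain S2 where S2: "finite S2" "S2 \<subseteq> carrier B" "generate B S2 = \<eta> ` N1"
        by (rule image_kernel_finitely_generated[OF R \<pi> \<theta>K[unfolded A_def] \<eta>K, folded A_def,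
              folded N1_def N2_def], rule comm, assumption, assumption, rule 3(1), rule that)
      obtain S1 where S1: "finite S1" "S1 \<subseteq> carrier A" "generate A S1 = \<theta> ` N2"
        by (rule image_kernel_finitely_generated[OF R \<pi> \<eta>K[unfolded B_def] \<theta>K, folded B_def,
              folded N1_def N2_def], rule comm[symmetric], assumption, assumption, rule 3(2), rule that)
      have sH: "subgroup (\<theta> ` H) A" "subgroup (\<eta> ` H) B"
        using \<theta>.subgroup_img_is_subgroup[OF H] \<eta>.subgroup_img_is_subgroup[OF H] by auto
      have sL: "subgroup (\<theta> ` N2) A" "subgroup (\<eta> ` N1) B"
        using \<theta>.H.generate_is_subgroup[OF S1(2)] \<eta>.H.generate_is_subgroup[OF S2(2)] S1(3) S2(3) by auto
      have conj: "h \<otimes>\<^bsub>G\<^esub> k \<otimes>\<^bsub>G\<^esub> inv\<^bsub>G\<^esub> h \<in> H" if "h \<in> H" "k \<in> H" for h k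
        using that by (intro subgroup.m_closed[OF H] subgroup.m_inv_closed[OF H])
      have fin1: "finite ((\<lambda>p. p <#\<^bsub>A\<^esub> \<theta> ` N2) ` \<theta> ` H)"
        unfolding A_def
      proof (rule finite_index_if_finitely_generated_normal[OF _ S1(1) _ S1(3)[symmetric, unfolded A_def]])
        show "p \<otimes>\<^bsub>free_group X\<^esub> l \<otimes>\<^bsub>free_group X\<^esub> inv\<^bsub>free_group X\<^esub> p \<in> \<theta> ` N2"
          if pl: "p \<in> \<theta> ` H" "l \<in> \<theta> ` N2" for p l
        proof -
          obtain h k where hk: "h \<in> H" "p = \<theta> h" "k \<in> N2" "l = \<theta> k" using pl by blast
          have "h \<otimes>\<^bsub>G\<^esub> k \<otimes>\<^bsub>G\<^esub> inv\<^bsub>G\<^esub> h \<in> N2" using hk conj HG by (simp add: N2_iff)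
          moreover have "\<theta> (h \<otimes>\<^bsub>G\<^esub> k \<otimes>\<^bsub>G\<^esub> inv\<^bsub>G\<^esub> h) = p \<otimes>\<^bsub>A\<^esub> l \<otimes>\<^bsub>A\<^esub> inv\<^bsub>A\<^esub> p"
            using hk HG by (simp add: N2_iff)
          ultimately show ?thesis by (metis A_def imageI)
        qed
      qed (use sH S1 3 in \<open>auto simp: A_def N2_iff\<close>)
      have fin2: "finite ((\<lambda>p. p <#\<^bsub>B\<^esub> \<eta> ` N1) ` \<eta> ` H)"
        unfolding B_def
      proof (rule finite_index_if_finitely_generated_normal[OF _ S2(1) _ S2(3)[symmetric, unfolded B_def]])
        show "p \<otimes>\<^bsub>free_group Y\<^esub> l \<otimes>\<^bsub>free_group Y\<^esub> inv\<^bsub>free_group Y\<^esub> p \<in> \<eta> ` N1"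
          if pl: "p \<in> \<eta> ` H" "l \<in> \<eta> ` N1" for p l
        proof -
          obtain h k where hk: "h \<in> H" "p = \<eta> h" "k \<in> N1" "l = \<eta> k" using pl by blast
          have "h \<otimes>\<^bsub>G\<^esub> k \<otimes>\<^bsub>G\<^esub> inv\<^bsub>G\<^esub> h \<in> N1" using hk conj HG by (simp add: N1_iff)
          moreover have "\<eta> (h \<otimes>\<^bsub>G\<^esub> k \<otimes>\<^bsub>G\<^esub> inv\<^bsub>G\<^esub> h) = p \<otimes>\<^bsub>B\<^esub> l \<otimes>\<^bsub>B\<^esub> inv\<^bsub>B\<^esub> p"
            using hk HG by (simp add: N1_iff)
          ultimately show ?thesis by (metis B_def imageI)
        qed
      qed (use sH S2 3 in \<open>auto simp: B_def N1_iff\<close>)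
      show ?thesis
      proof (rule separable_if_finite_index[OF \<theta> \<eta> H _ _ _ _ _ _ _ _ _ _ _ _ _ x])
        show "finite (\<theta> ` gens)" "finite (\<eta> ` gens)" using gens(1) by auto
        show "\<theta> ` gens \<subseteq> carrier (free_group X)" "\<eta> ` gens \<subseteq> carrier (free_group Y)"
          using \<theta>H(2) \<eta>H(2) by (simp_all add: A_def B_def)
        show "subgroup (\<theta> ` N2) (free_group X)" "subgroup (\<eta> ` N1) (free_group Y)"
          using sL by (simp_all add: A_def B_def)
        show "finite ((\<lambda>p. p <#\<^bsub>free_group X\<^esub> \<theta> ` N2) ` generate (free_group X) (\<theta> ` gens))"
          "finite ((\<lambda>p. p <#\<^bsub>free_group Y\<^esub> \<eta> ` N1) ` generate (free_group Y) (\<eta> ` gens))"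
          using fin1 fin2 \<theta>H(1) \<eta>H(1) by (simp_all add: A_def B_def)
        show "\<theta> ` H \<subseteq> generate (free_group X) (\<theta> ` gens)" "\<eta> ` H \<subseteq> generate (free_group Y) (\<eta> ` gens)"
          "\<theta> ` N2 \<subseteq> generate (free_group X) (\<theta> ` gens)" "\<eta> ` N1 \<subseteq> generate (free_group Y) (\<eta> ` gens)"
          using \<theta>H(1) \<eta>H(1) by (auto simp: A_def B_def N1_iff N2_iff)
        show "g \<in> H" if g: "g \<in> carrier G" "\<theta> g \<in> \<theta> ` N2" "\<eta> g \<in> \<eta> ` N1" for g
        proof -
          obtain k k' where k: "k \<in> N2" "\<theta> g = \<theta> k" "k' \<in> N1" "\<eta> g = \<eta> k'" using g by blast
          \<comment> \<open>\<open>k\<close> supplies the first coordinate and \<open>k'\<close> the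
            second; each is trivial in the other one.\<close>
          have "g = k \<otimes>\<^bsub>G\<^esub> k'" using g(1) k HG by (intro eqI) (auto simp: N1_iff N2_iff)
          then show ?thesis using k subgroup.m_closed[OF H] by (simp add: N1_iff N2_iff)
        qed
      qed
    qed
  qed
  have "H = \<Inter> {H <#>\<^bsub>G\<^esub> N |N. finite_index_normal G N}"
  proof (rule equalityI)
    have "h \<in> H <#>\<^bsub>G\<^esub> M" if "h \<in> H" "finite_index_normal G M" for h M
    proof -
      have "\<one>\<^bsub>G\<^esub> \<in> M"
        using that by (auto simp: finite_index_normal_def intro: subgroup.one_closed normal_imp_subgroup)
      moreover have "h = h \<otimes>\<^bsub>G\<^esub> \<one>\<^bsub>G\<^esub>" using HG[OF that(1)] by simp
      ultimately show ?thesis using that(1) unfolding set_mult_def by blast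
    qed
    then show "H \<subseteq> \<Inter> {H <#>\<^bsub>G\<^esub> N |N. finite_index_normal G N}" by blast
    show "\<Inter> {H <#>\<^bsub>G\<^esub> N |N. finite_index_normal G N} \<subseteq> H"
    proof (rule subsetI, rule ccontr)
      fix x assume x: "x \<in> \<Inter> {H <#>\<^bsub>G\<^esub> N |N. finite_index_normal G N}" and "x \<notin> H"
      have "x \<in> H <#>\<^bsub>G\<^esub> carrier G" using x \<theta>.G.finite_index_normal_carrier by blast
      then have "x \<in> carrier G" using HG by (auto simp: set_mult_def)
      from sep[OF this \<open>x \<notin> H\<close>] show False using x by blast
    qed
  qed
  then show ?thesis by (simp add: \<theta>.G.closedin_profinite_topology_iff[OF H, symmetric])
qed

theorem corollary1:
  fixes F2 :: "('a, 'm) monoid_scheme" and F2' :: "('b, 'n) monoid_scheme"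
    and H :: "('a \<times> 'b) set"
  assumes "free_group_of_rank 2 F2"
    and "group F2'" and "F2' \<cong> F2"
    and "subgroup H (F2 \<times>\<times> F2')"
    and "finitely_presented ((F2 \<times>\<times> F2')\<lparr>carrier := H\<rparr>)"
  shows "closedin (profinite_topology (F2 \<times>\<times> F2')) H"
proof -
  have F2: "group F2" using assms(1) by (simp add: free_group_of_rank_def)
  obtain \<phi> where \<phi>: "\<phi> \<in> iso F2 (free_group {..<2::nat})"
    using assms(1) by (auto simp: free_group_of_rank_def is_iso_def)
  obtain \<psi> where \<psi>: "\<psi> \<in> iso F2' F2" using assms(3) by (auto simp: is_iso_def)
  have \<phi>\<psi>: "\<phi> \<circ> \<psi> \<in> iso F2' (free_group {..<2::nat})"
    using iso_set_trans[OF \<psi> \<phi>] .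
  interpret \<phi>: group_hom F2 "free_group {..<2::nat}" \<phi>
    using \<phi> F2 group_free_group by (simp add: group_hom_def group_hom_axioms_def iso_def)
  interpret \<phi>\<psi>: group_hom F2' "free_group {..<2::nat}" "\<phi> \<circ> \<psi>"
    using \<phi>\<psi> assms(2) group_free_group by (simp add: group_hom_def group_hom_axioms_def iso_def)
  have G: "group (F2 \<times>\<times> F2')" by (rule DirProd_group[OF F2 assms(2)])
  show ?thesis
  \<comment> \<open>Both factors are identified with one concrete free group. The coordinate maps
    are projections followed by isomorphisms, hence jointly injective.\<close>
  proof (rule closed_if_finitely_presented[OF _ _ _ _ _ assms(4,5)])
    show "group_hom (F2 \<times>\<times> F2') (free_group {..<2::nat}) (\<phi> \<circ> fst)"
      using G group_free_group iffD2[OF hom_of_fst[OF assms(2)] \<phi>.homh]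
      by (simp add: group_hom_def group_hom_axioms_def)
    show "group_hom (F2 \<times>\<times> F2') (free_group {..<2::nat}) ((\<phi> \<circ> \<psi>) \<circ> snd)"
      using G group_free_group iffD2[OF hom_of_snd[OF F2] \<phi>\<psi>.homh]
      by (simp add: group_hom_def group_hom_axioms_def)
    fix g assume "g \<in> carrier (F2 \<times>\<times> F2')" "(\<phi> \<circ> fst) g = \<one>\<^bsub>free_group {..<2::nat}\<^esub>"
      "((\<phi> \<circ> \<psi>) \<circ> snd) g = \<one>\<^bsub>free_group {..<2::nat}\<^esub>"
    then show "g = \<one>\<^bsub>F2 \<times>\<times> F2'\<^esub>"
      using \<phi>.iso_iff \<phi>\<psi>.iso_iff \<phi> \<phi>\<psi> by (auto simp: DirProd_def)
  qed simp_all
qed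

end
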